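(* Let $\mathcal{A}=\{H_1,\dots,H_m\}$, $H_i=\{z\in\mathbb{R}^d:\eta_i\cdot z=0\}$ with $\eta_i\neq 0$, be an essential central real hyperplane arrangement in $\mathbb{R}^d$, and let $Z=\{\sum_{i=1}^m\lambda_i\eta_i : -1\le\lambda_i\le 1\}$ be an associated zonotope. Then for each $i$, $\alpha_i(Z)$ equals the absolute value of the coefficient of $t^i$ in the characteristic polynomial of the order dual $L^*$ of the intersection lattice $L(\mathcal{A})$; explicitly, $\alpha_i(Z)=\bigl|\sum_{x\in L(\mathcal{A}),\ \dim x=d-i}\mu_{\mathcal{A}}(x,\hat 1)\bigr|$.
   Context: The arrangement is essential if the normals $\eta_i$ span $\mathbb{R}^d$. The intersection lattice $L(\mathcal{A})$ consists of all intersections of subcollections of the $H_i$ (with $\mathbb{R}^d$ the empty intersection), ordered by reverse inclusion, with bottom $\hat 0=\mathbb{R}^d$ and top $\hat 1=\{0\}$; $\mu_{\mathcal{A}}$ is its Möbius function. The order dual $L^*$ is $L(\mathcal{A})$ with the order reversed; it is graded of rank $d$ with minimum $\{0\}$, the rank of $x$ in $L^*$ being $\dim x$, and $\mu_{L^*}(\{0\},x)=\mu_{\mathcal{A}}(x,\hat 1)$. For a graded poset $P$ of rank $n$ with minimum $\hat 0$ and rank function $\rho$, its characteristic polynomial is $\chi_P(t)=\sum_{x\in P}\mu_P(\hat 0,x)\,t^{\,n-\rho(x)}$. For a polytope $P$ and a face $F$, $\alpha(P,F)$ is the fraction of the volume of a sufficiently small ball centered at a relative interior point of $F$ that lies in $P$,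 and $\alpha_k(P)=\sum_{\dim F=k}\alpha(P,F)$. *)

theory Defs
  imports "HOL-Analysis.Analysis" "HOL-Computational_Algebra.Polynomial"
begin

section \<open>Finite posets\<close>

text \<open>
  A poset is given by its (reflexive) order relation \<open>r\<close>, with carrier \<open>Field r\<close>;
  the order dual of \<open>r\<close> is \<open>r\<inverse>\<close>.
  In \<open>moebius_mu\<close> the guard on \<open>r\<close> makes the usual recursion terminate.
\<close>

function moebius_mu :: "'b rel \<Rightarrow> 'b \<Rightarrow> 'b \<Rightarrow> int" where
  "moebius_mu r x y =
    (if finite r \<and> Partial_order r \<and> (x, y) \<in> r then
       (if x = y then 1
        else - (\<Sum>z\<in>{z. (x, z) \<in> r \<and> (z, y) \<in> r \<and> z \<noteq> y}. moebius_mu r x z))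
     else 0)"
  by pat_completeness auto
termination
proof (relation "Wellfounded.measure (\<lambda>(r, x, y). card {w. (w, y) \<in> r})", goal_cases)
  case 1
  show ?case by simp
next
  case (2 r x y z)
  then have po: "Partial_order r" and zy: "(z, y) \<in> r" "z \<noteq> y" and fin: "finite r"
    by auto
  have "{w. (w, y) \<in> r} \<subseteq> fst ` r"
    by force
  then have "finite {w. (w, y) \<in> r}"
    using fin finite_subset by blast
  moreover have "{w. (w, z) \<in> r} \<subset> {w. (w, y) \<in> r}"
  proof
    show "{w. (w, z) \<in> r} \<subseteq> {w. (w, y) \<in> r}"
      using partial_order_onD(2)[OF po] zy(1) by (auto dest: transD)
    have "(y, y) \<in> r"
      using partial_order_onD(1)[OF po] zy(1) by (meson FieldI2 refl_onD)
    moreover have "(y, z) \<notin> r"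
      using partial_order_onD(3)[OF po] zy by (auto dest: antisymD)
    ultimately show "{w. (w, z) \<in> r} \<noteq> {w. (w, y) \<in> r}"
      by blast
  qed
  ultimately show ?case
    by (simp add: psubset_card_mono)
qed

declare moebius_mu.simps [simp del]

definition poset_min :: "'b rel \<Rightarrow> 'b" where
  "poset_min r = (THE b. b \<in> Field r \<and> (\<forall>x\<in>Field r. (b, x) \<in> r))"

text \<open>
  A chain \<open>C\<close> has length \<open>card C - 1\<close>.  In a graded poset with a minimum, the rank of the
  poset is the maximal length of a chain, and the rank of \<open>x\<close> is the maximal length of a
  chain of elements below \<open>x\<close>.
\<close>

definition poset_rank :: "'b rel \<Rightarrow> nat" where
  "poset_rank r = Max ((\<lambda>C. card C - 1) ` Chains r)"

definition rank_of :: "'b rel \<Rightarrow> 'b \<Rightarrow> nat" where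
  "rank_of r x = Max ((\<lambda>C. card C - 1) ` {C \<in> Chains r. \<forall>y\<in>C. (y, x) \<in> r})"

definition characteristic_poly :: "'b rel \<Rightarrow> int poly" where
  "characteristic_poly r =
    (\<Sum>x\<in>Field r. monom (moebius_mu r (poset_min r) x) (poset_rank r - rank_of r x))"


section \<open>Arrangements and zonotopes\<close>

definition arrangement :: "nat \<Rightarrow> (nat \<Rightarrow> 'a::euclidean_space) \<Rightarrow> 'a set set" where
  "arrangement m \<eta> = (\<lambda>j. {z. \<eta> j \<bullet> z = 0}) ` {1..m}"

text \<open>Here \<open>\<Inter>{} = UNIV\<close>, so the whole space is a member.\<close>

definition intersection_lattice :: "'a set set \<Rightarrow> 'a set set" where
  "intersection_lattice A = Inter ` Pow A"

definition intersection_order :: "'a set set \<Rightarrow> 'a set rel" where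
  "intersection_order A = relation_of (\<supseteq>) (intersection_lattice A)"

lemma Field_intersection_order: "Field (intersection_order A) = intersection_lattice A"
  by (auto simp: intersection_order_def relation_of_def Field_def)

lemma Partial_order_intersection_order: "Partial_order (intersection_order A)"
  unfolding Field_intersection_order
  by (auto simp: intersection_order_def relation_of_def partial_order_on_def preorder_on_def
      refl_on_def trans_def antisym_def)

lemma finite_intersection_order:
  assumes "finite A"
  shows "finite (intersection_order A)"
proof -
  have "intersection_order A \<subseteq> intersection_lattice A \<times> intersection_lattice A"
    by (auto simp: intersection_order_def relation_of_def)
  moreover have "finite (intersection_lattice A)"
    using assms by (simp add: intersection_lattice_def)
  ultimately show ?thesis
    using finite_subset by blast
qed

definition zonotope :: "nat \<Rightarrow> (nat \<Rightarrow> 'a::euclidean_space) \<Rightarrow> 'a set" where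
  "zonotope m \<eta> =
    {\<Sum>j=1..m. c j *\<^sub>R \<eta> j | c :: nat \<Rightarrow> real. \<forall>j\<in>{1..m}. - 1 \<le> c j \<and> c j \<le> 1}"


section \<open>Solid angles\<close>

text \<open>
  For a nonempty face \<open>F\<close> of a polytope \<open>P\<close> the volume fraction is the same for all relative
  interior points of \<open>F\<close> and all sufficiently small radii; \<open>solid_angle P F\<close> is that common
  value.
\<close>

definition solid_angle :: "'a::euclidean_space set \<Rightarrow> 'a set \<Rightarrow> real" where
  "solid_angle P F =
    (THE a. \<forall>x\<in>rel_interior F. \<forall>\<^sub>F \<epsilon> in at_right 0.
       measure lebesgue (ball x \<epsilon> \<inter> P) / measure lebesgue (ball x \<epsilon>) = a)"

definition angle_sum :: "nat \<Rightarrow> 'a::euclidean_space set \<Rightarrow> real" where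
  "angle_sum k P = (\<Sum>F\<in>{F. F face_of P \<and> aff_dim F = int k}. solid_angle P F)"

end

theory Submission
  imports Defs
begin

text \<open>
  The faces of the zonotope parallel to the span of a set of normals correspond to the chambers that
  the arrangement cuts out in the orthogonal flat \<open>x\<close>, and the tangent cone of the zonotope along
  such a face is the polar cone of the closed chamber. So the solid angles of these faces add up to
  the average, over directions \<open>v\<close>, of the number of chambers in \<open>x\<close> on which \<open>v\<close> is nonpositive.
  For generic \<open>v\<close> this number does not depend on \<open>v\<close>: it satisfies the same deletion-restriction
  recursion as the alternating sum over sets of hyperplanes that, by Whitney's theorem, computes the
  Moebius function, so it equals \<open>(- 1) ^ dim x * \<mu>(x, {0})\<close>. As that sign is constant over the flats
  of a given dimension, summing over the flats gives the result.
\<close>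

section \<open>Counting chambers by deletion and restriction\<close>

text \<open>A single solid angle of the zonotope has no closed form in general; only the total over
  all faces orthogonal to one flat is combinatorial. This is why faces are grouped by flats and why
  the total is found as the integral of an almost everywhere constant count instead of angle by
  angle. The count obeys a recursion because of duality: when a hyperplane divides a closed cone,
  the polars of the two halves intersect in the polar of the whole cone, and their union is the
  polar of the cut. Inclusion-exclusion then gives "two halves = whole + cut" for every direction
  \<open>v\<close>. Genericity enters only at the base of the induction: there the cell is a
  subspace, its polar is the orthogonal complement, and \<open>v\<close> has to avoid it unless the
  subspace is \<open>{0}\<close>. Deletion-restriction has a plus for cells and a minus for Whitney
  sums; restriction lowers the dimension by one, so the factor \<open>(- 1) ^ dim x\<close>
  reconciles them.\<close>

definition flat :: "(nat \<Rightarrow> 'a::euclidean_space) \<Rightarrow> nat set \<Rightarrow> 'a set" where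
  "flat \<eta> S = {z. \<forall>j\<in>S. \<eta> j \<bullet> z = 0}"

text \<open>A set \<open>P\<close> of indices encodes a sign pattern: positive on \<open>P\<close>,
  negative elsewhere. Sums over chambers thus become sums over \<open>Pow J\<close>, and adding a
  hyperplane \<open>h\<close> pairs \<open>P\<close> with \<open>insert h P\<close>.\<close>

definition signed_normal :: "nat set \<Rightarrow> (nat \<Rightarrow> 'a::euclidean_space) \<Rightarrow> nat \<Rightarrow> 'a" where
  "signed_normal P \<eta> j = (if j \<in> P then \<eta> j else - \<eta> j)"

definition open_cell :: "(nat \<Rightarrow> 'a::euclidean_space) \<Rightarrow> 'a set \<Rightarrow> nat set \<Rightarrow> 'a set" where
  "open_cell b x J = {u \<in> x. \<forall>j\<in>J. b j \<bullet> u > 0}"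

definition closed_cell :: "(nat \<Rightarrow> 'a::euclidean_space) \<Rightarrow> 'a set \<Rightarrow> nat set \<Rightarrow> 'a set" where
  "closed_cell b x J = {u \<in> x. \<forall>j\<in>J. b j \<bullet> u \<ge> 0}"

definition polar_cone :: "'a::euclidean_space set \<Rightarrow> 'a set" where
  "polar_cone C = {v. \<forall>z\<in>C. v \<bullet> z \<le> 0}"

definition whitney_sum :: "(nat \<Rightarrow> 'a::euclidean_space) \<Rightarrow> 'a set \<Rightarrow> 'a set \<Rightarrow> nat set \<Rightarrow> int" where
  "whitney_sum \<eta> x y J = (\<Sum>S\<in>Pow J. if x \<inter> flat \<eta> S = y then (- 1) ^ card S else 0)"

text \<open>For generic \<open>v\<close> this is the number of chambers on one side of the
  hyperplane orthogonal to \<open>v\<close>. Nonemptiness is tested on the open cell because the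
  closed cell of any sign pattern contains 0.\<close>

definition cell_count :: "(nat \<Rightarrow> 'a::euclidean_space) \<Rightarrow> 'a \<Rightarrow> 'a set \<Rightarrow> nat set \<Rightarrow> int" where
  "cell_count \<eta> v x J =
    (\<Sum>P\<in>Pow J. of_bool (open_cell (signed_normal P \<eta>) x J \<noteq> {}
      \<and> v \<in> polar_cone (closed_cell (signed_normal P \<eta>) x J)))"

lemma subspace_flat: "subspace (flat \<eta> S)"
  by (auto simp: flat_def subspace_def inner_right_distrib)

lemma flat_insert: "flat \<eta> (insert h S) = {z. \<eta> h \<bullet> z = 0} \<inter> flat \<eta> S"
  by (auto simp: flat_def)

lemma sum_Pow_insert:
  fixes f :: "'b set \<Rightarrow> 'c::comm_monoid_add"
  assumes "finite A" "a \<notin> A"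
  shows "(\<Sum>S\<in>Pow (insert a A). f S) = (\<Sum>S\<in>Pow A. f S + f (insert a S))"
proof -
  have "(\<Sum>S\<in>Pow (insert a A). f S) = (\<Sum>S\<in>Pow A. f S) + (\<Sum>S\<in>insert a ` Pow A. f S)"
    unfolding Pow_insert using assms by (intro sum.union_disjoint) auto
  also have "(\<Sum>S\<in>insert a ` Pow A. f S) = (\<Sum>S\<in>Pow A. f (insert a S))"
    using assms by (subst sum.reindex) (auto simp: inj_on_def)
  finally show ?thesis
    by (simp add: sum.distrib)
qed

lemma sum_Pow_alternating:
  assumes "finite A"
  shows "(\<Sum>S\<in>Pow A. (- 1 :: int) ^ card S) = (if A = {} then 1 else 0)"
proof (cases "A = {}")
  case False
  then obtain a B where A: "A = insert a B" "a \<notin> B"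
    by (metis ex_in_conv mk_disjoint_insert)
  then have "finite B"
    using assms by simp
  then have "(- 1 :: int) ^ card S + (- 1) ^ card (insert a S) = 0" if "S \<in> Pow B" for S
    using that A(2) finite_subset[of S B] by (auto simp: card_insert_if)
  then show ?thesis
    using A \<open>finite B\<close> by (simp add: sum_Pow_insert)
qed simp

lemma whitney_sum_insert:
  assumes "finite J" "h \<notin> J"
  shows "whitney_sum \<eta> x y (insert h J) =
    whitney_sum \<eta> x y J - whitney_sum \<eta> (x \<inter> {z. \<eta> h \<bullet> z = 0}) y J"
proof -
  have "(- 1 :: int) ^ card (insert h S) = - ((- 1) ^ card S)" if "S \<in> Pow J" for S
    using that assms finite_subset[of S J] by (auto simp: card_insert_if)
  then show ?thesis
    unfolding whitney_sum_def sum_Pow_insert[OF assms] sum_subtractf[symmetric]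
    by (intro sum.cong) (auto simp: flat_insert Int_assoc)
qed

section \<open>Cells and their polars when one more hyperplane is added\<close>

lemma open_cell_insert: "open_cell b x (insert h J) = open_cell b x J \<inter> {u. b h \<bullet> u > 0}"
  by (auto simp: open_cell_def)

lemma closed_cell_insert: "closed_cell b x (insert h J) = closed_cell b x J \<inter> {u. b h \<bullet> u \<ge> 0}"
  by (auto simp: closed_cell_def)

lemma open_cell_Int: "open_cell b (x \<inter> y) J = open_cell b x J \<inter> y"
  by (auto simp: open_cell_def)

lemma closed_cell_Int: "closed_cell b (x \<inter> y) J = closed_cell b x J \<inter> y"
  by (auto simp: closed_cell_def)

lemma open_cell_cong: "(\<And>j. j \<in> J \<Longrightarrow> b j = c j) \<Longrightarrow> open_cell b x J = open_cell c x J"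
  by (auto simp: open_cell_def)

lemma closed_cell_cong: "(\<And>j. j \<in> J \<Longrightarrow> b j = c j) \<Longrightarrow> closed_cell b x J = closed_cell c x J"
  by (auto simp: closed_cell_def)

lemma open_cell_perturb:
  assumes "finite J" "subspace x" "u \<in> open_cell b x J" "w \<in> x"
  obtains t where "t > 0" "u + t *\<^sub>R w \<in> open_cell b x J"
proof -
  have "\<forall>\<^sub>F t in at_right 0. \<forall>j\<in>J. b j \<bullet> (u + t *\<^sub>R w) > 0"
  proof (rule eventually_ball_finite[OF assms(1)], intro ballI)
    fix j assume "j \<in> J"
    have "((\<lambda>t. b j \<bullet> (u + t *\<^sub>R w)) \<longlongrightarrow> b j \<bullet> (u + 0 *\<^sub>R w)) (at_right 0)"
      by (intro tendsto_intros)
    moreover have "b j \<bullet> (u + 0 *\<^sub>R w) > 0"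
      using assms(3) \<open>j \<in> J\<close> by (simp add: open_cell_def)
    ultimately show "\<forall>\<^sub>F t in at_right 0. b j \<bullet> (u + t *\<^sub>R w) > 0"
      by (rule order_tendstoD(1))
  qed
  then have "\<forall>\<^sub>F t in at_right 0. t > 0 \<and> (\<forall>j\<in>J. b j \<bullet> (u + t *\<^sub>R w) > 0)"
    using eventually_at_right_less by (rule eventually_conj[rotated])
  then obtain t :: real where "t > 0" "\<forall>j\<in>J. b j \<bullet> (u + t *\<^sub>R w) > 0"
    using eventually_happens' trivial_limit_at_right_real by blast
  then show ?thesis
    using that assms by (auto simp: open_cell_def subspace_add subspace_scale)
qed

lemma open_cell_meets_halfspace:
  assumes "finite J" "subspace x" "u \<in> open_cell b x J" "a \<bullet> u = 0" "w \<in> x" "a \<bullet> w \<noteq> 0"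
  shows "open_cell b x J \<inter> {u. a \<bullet> u > 0} \<noteq> {}"
proof -
  \<comment> \<open>Scaling \<open>w\<close> by \<open>a \<bullet> w\<close> makes its inner product
    with \<open>a\<close> a nonzero square, so the sign of \<open>a \<bullet> w\<close> does not
    matter.\<close>
  have "(a \<bullet> w) *\<^sub>R w \<in> x"
    using assms by (simp add: subspace_scale)
  from open_cell_perturb[OF assms(1-3) this] obtain t where
    "t > 0" and t: "u + t *\<^sub>R ((a \<bullet> w) *\<^sub>R w) \<in> open_cell b x J" .
  moreover have "a \<bullet> (u + t *\<^sub>R ((a \<bullet> w) *\<^sub>R w)) > 0"
    using \<open>t > 0\<close> assms(4,6) not_sum_squares_lt_zero[of "a \<bullet> w" 0]
    by (simp add: inner_right_distrib zero_less_mult_iff) (auto simp: mult_less_0_iff)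
  ultimately show ?thesis
    by blast
qed

lemma segment_meets_hyperplane:
  fixes p q :: "'a::real_inner"
  assumes "a \<bullet> p > 0" "a \<bullet> q < 0"
  obtains s t where "s > 0" "t > 0" "a \<bullet> (s *\<^sub>R p + t *\<^sub>R q) = 0"
proof -
  \<comment> \<open>Crosswise weights cancel. They need not sum to 1, since only cones are
    involved.\<close>
  have "a \<bullet> (- (a \<bullet> q) *\<^sub>R p + (a \<bullet> p) *\<^sub>R q) = 0"
    by (simp only: inner_right_distrib inner_scaleR_right) simp
  then show thesis
    using that[of "- (a \<bullet> q)" "a \<bullet> p"] assms by linarith
qed

lemma open_cell_meets_hyperplane:
  assumes "subspace x" "p \<in> open_cell b x J" "a \<bullet> p > 0" "q \<in> open_cell b x J" "a \<bullet> q < 0"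
  shows "open_cell b x J \<inter> {u. a \<bullet> u = 0} \<noteq> {}"
proof -
  obtain s t where st: "s > 0" "t > 0" "a \<bullet> (s *\<^sub>R p + t *\<^sub>R q) = 0"
    using segment_meets_hyperplane[OF assms(3,5)] .
  have "s *\<^sub>R p + t *\<^sub>R q \<in> open_cell b x J"
    using assms st by (auto simp: open_cell_def inner_right_distrib subspace_add subspace_scale
        intro!: add_pos_pos)
  then show ?thesis
    using st by blast
qed

text \<open>Once the open cell has a point \<open>u\<close>, its closure contains the closed cell:
  \<open>z + t *\<^sub>R u\<close> is in the open cell for every \<open>t > 0\<close> and tends to
  \<open>z\<close>.\<close>

lemma closed_cell_subset_halfspace:
  assumes "subspace x" "u \<in> open_cell b x J" "open_cell b x J \<subseteq> {u. a \<bullet> u \<ge> 0}"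
  shows "closed_cell b x J \<subseteq> {u. a \<bullet> u \<ge> 0}"
proof
  fix z assume z: "z \<in> closed_cell b x J"
  have "a \<bullet> (z + t *\<^sub>R u) \<ge> 0" if "t > 0" for t
  proof -
    have "z + t *\<^sub>R u \<in> open_cell b x J"
      using assms z that
      by (auto simp: open_cell_def closed_cell_def inner_right_distrib subspace_add subspace_scale
          intro!: add_nonneg_pos)
    then show ?thesis
      using assms(3) by blast
  qed
  then have "\<forall>\<^sub>F t in at_right 0. a \<bullet> (z + t *\<^sub>R u) \<ge> 0"
    by (auto simp: eventually_at_right_field intro: exI[of _ 1])
  moreover have "((\<lambda>t. a \<bullet> (z + t *\<^sub>R u)) \<longlongrightarrow> a \<bullet> (z + 0 *\<^sub>R u)) (at_right 0)"
    by (intro tendsto_intros)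
  ultimately have "a \<bullet> (z + 0 *\<^sub>R u) \<ge> 0"
    by (intro tendsto_lowerbound[where F = "at_right 0"]) auto
  then show "z \<in> {u. a \<bullet> u \<ge> 0}"
    by simp
qed

text \<open>Inclusion-exclusion for the polars of the two halves. The nontrivial part is that a
  \<open>v\<close> in the polar of the cut lies in one of the two: otherwise points \<open>p\<close>
  and \<open>q\<close> strictly on either side with \<open>v\<close> positive on both have a
  positive combination in the cut on which \<open>v\<close> is positive.\<close>

lemma polar_closed_cell_split:
  fixes v :: "'a::euclidean_space" and b :: "nat \<Rightarrow> 'a" and J :: "nat set"
  assumes "subspace x"
  defines "C \<equiv> closed_cell b x J"
  shows "(of_bool (v \<in> polar_cone (C \<inter> {u. a \<bullet> u \<ge> 0})) :: int)
      + of_bool (v \<in> polar_cone (C \<inter> {u. - a \<bullet> u \<ge> 0}))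
    = of_bool (v \<in> polar_cone C) + of_bool (v \<in> polar_cone (C \<inter> {u. a \<bullet> u = 0}))"
proof -
  let ?p = "v \<in> polar_cone (C \<inter> {u. a \<bullet> u \<ge> 0})"
  let ?n = "v \<in> polar_cone (C \<inter> {u. - a \<bullet> u \<ge> 0})"
  let ?z = "v \<in> polar_cone (C \<inter> {u. a \<bullet> u = 0})"
  have 1: "v \<in> polar_cone C \<longleftrightarrow> ?p \<and> ?n"
  proof
    assume pn: "?p \<and> ?n"
    have "v \<bullet> z \<le> 0" if "z \<in> C" for z
      using pn that by (cases "a \<bullet> z \<ge> 0") (auto simp: polar_cone_def)
    then show "v \<in> polar_cone C"
      by (simp add: polar_cone_def)
  qed (auto simp: polar_cone_def)
  have 2: "?p \<or> ?n \<Longrightarrow> ?z"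
    by (auto simp: polar_cone_def)
  have 3: "?p \<or> ?n" if ?z
  proof (rule ccontr)
    assume "\<not> ?thesis"
    then obtain p q where p: "p \<in> C" "a \<bullet> p \<ge> 0" "v \<bullet> p > 0"
      and q: "q \<in> C" "a \<bullet> q \<le> 0" "v \<bullet> q > 0"
      by (auto simp: polar_cone_def not_le)
    have "v \<bullet> z \<le> 0" if "z \<in> C" "a \<bullet> z = 0" for z
      using \<open>?z\<close> that by (simp add: polar_cone_def)
    then have "a \<bullet> p \<noteq> 0" "a \<bullet> q \<noteq> 0"
      using p q by (metis not_le)+
    then have "a \<bullet> p > 0" "a \<bullet> q < 0"
      using p(2) q(2) by linarith+
    then obtain s t where st: "s > 0" "t > 0" "a \<bullet> (s *\<^sub>R p + t *\<^sub>R q) = 0"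
      by (rule segment_meets_hyperplane)
    have "s *\<^sub>R p + t *\<^sub>R q \<in> C"
      using assms st p(1) q(1)
      by (auto simp: closed_cell_def inner_right_distrib subspace_add subspace_scale)
    then have "v \<bullet> (s *\<^sub>R p + t *\<^sub>R q) \<le> 0"
      using that st by (auto simp: polar_cone_def)
    moreover have "v \<bullet> (s *\<^sub>R p + t *\<^sub>R q) > 0"
      using st p q by (simp add: inner_right_distrib add_pos_pos)
    ultimately show False
      by simp
  qed
  show ?thesis
    using 1 2 3 by auto
qed

text \<open>
  If the hyperplane cuts the cell, the two halves and the cut are all nonempty and polarity
  splits as in \<open>polar_closed_cell_split\<close>; otherwise exactly one half is nonempty, and it is the whole cell.
\<close>

lemma cell_split:
  fixes v :: "'a::euclidean_space" and b :: "nat \<Rightarrow> 'a" and J :: "nat set"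
  assumes J: "finite J" and x: "subspace x" and w: "w \<in> x" "a \<bullet> w \<noteq> 0"
  defines "R \<equiv> open_cell b x J" and "C \<equiv> closed_cell b x J"
  shows "(of_bool (R \<inter> {u. a \<bullet> u > 0} \<noteq> {} \<and> v \<in> polar_cone (C \<inter> {u. a \<bullet> u \<ge> 0})) :: int)
      + of_bool (R \<inter> {u. - a \<bullet> u > 0} \<noteq> {} \<and> v \<in> polar_cone (C \<inter> {u. - a \<bullet> u \<ge> 0}))
    = of_bool (R \<noteq> {} \<and> v \<in> polar_cone C)
      + of_bool (R \<inter> {u. a \<bullet> u = 0} \<noteq> {} \<and> v \<in> polar_cone (C \<inter> {u. a \<bullet> u = 0}))"
proof -
  have w': "- a \<bullet> w \<noteq> 0"
    using w by simp
  consider "R = {}" | "R \<inter> {u. a \<bullet> u = 0} \<noteq> {}"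
    | "R \<noteq> {}" "R \<subseteq> {u. a \<bullet> u > 0}" | "R \<noteq> {}" "R \<subseteq> {u. - a \<bullet> u > 0}"
  proof -
    have "R \<subseteq> {u. a \<bullet> u > 0} \<or> R \<subseteq> {u. - a \<bullet> u > 0}" if "R \<inter> {u. a \<bullet> u = 0} = {}"
    proof (rule ccontr)
      assume "\<not> ?thesis"
      then obtain p q where "p \<in> R" "\<not> a \<bullet> p > 0" "q \<in> R" "\<not> a \<bullet> q < 0"
        by auto
      moreover from this that have "a \<bullet> p < 0" "a \<bullet> q > 0"
        by fastforce+
      ultimately show False
        using that open_cell_meets_hyperplane[OF x, of q b J a p] by (auto simp: R_def)
    qed
    then show thesis
      using that by blast
  qed
  then show ?thesis
  proof cases
    case 1
    then show ?thesis by simp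
  next
    case 2
    then obtain u where u: "u \<in> R" "a \<bullet> u = 0"
      by auto
    then have "R \<inter> {u. a \<bullet> u > 0} \<noteq> {}" "R \<inter> {u. - a \<bullet> u > 0} \<noteq> {}"
      unfolding R_def
      using open_cell_meets_halfspace[OF J x _ _ w] open_cell_meets_halfspace[OF J x _ _ w(1) w']
      by simp_all
    moreover have "R \<noteq> {}"
      using u by blast
    ultimately show ?thesis
      using 2 polar_closed_cell_split[OF x, of v b J a] by (simp add: C_def)
  next
    case 3
    then obtain u where "u \<in> R"
      by blast
    moreover have "R \<subseteq> {u. a \<bullet> u \<ge> 0}"
      using 3(2) by auto
    ultimately have "C \<subseteq> {u. a \<bullet> u \<ge> 0}"
      unfolding C_def R_def by (rule closed_cell_subset_halfspace[OF x])
    then have "C \<inter> {u. a \<bullet> u \<ge> 0} = C"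
      by blast
    moreover have "R \<inter> {u. a \<bullet> u > 0} = R" "R \<inter> {u. - a \<bullet> u > 0} = {}" "R \<inter> {u. a \<bullet> u = 0} = {}"
      using 3 by auto
    ultimately show ?thesis
      by simp
  next
    case 4
    then obtain u where "u \<in> R"
      by blast
    moreover have "R \<subseteq> {u. - a \<bullet> u \<ge> 0}"
      using 4(2) by auto
    ultimately have "C \<subseteq> {u. - a \<bullet> u \<ge> 0}"
      unfolding C_def R_def by (rule closed_cell_subset_halfspace[OF x])
    then have "C \<inter> {u. - a \<bullet> u \<ge> 0} = C"
      by blast
    moreover have "R \<inter> {u. - a \<bullet> u > 0} = R" "R \<inter> {u. a \<bullet> u > 0} = {}" "R \<inter> {u. a \<bullet> u = 0} = {}"
      using 4 by auto
    ultimately show ?thesis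
      by simp
  qed
qed

text \<open>The patterns \<open>P\<close> and \<open>insert h P\<close> are the two halves of the
  cell of \<open>P\<close>, so \<open>cell_split\<close> is summed over these pairs.\<close>

lemma cell_count_insert:
  fixes \<eta> :: "nat \<Rightarrow> 'a::euclidean_space"
  assumes "finite J" "h \<notin> J" "subspace x" "\<not> x \<subseteq> {z. \<eta> h \<bullet> z = 0}"
  shows "cell_count \<eta> v x (insert h J) = cell_count \<eta> v x J + cell_count \<eta> v (x \<inter> {z. \<eta> h \<bullet> z = 0}) J"
proof -
  obtain w where w: "w \<in> x" "\<eta> h \<bullet> w \<noteq> 0"
    using assms(4) by blast
  have "(of_bool (open_cell (signed_normal P \<eta>) x (insert h J) \<noteq> {}
          \<and> v \<in> polar_cone (closed_cell (signed_normal P \<eta>) x (insert h J))) :: int)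
      + of_bool (open_cell (signed_normal (insert h P) \<eta>) x (insert h J) \<noteq> {}
          \<and> v \<in> polar_cone (closed_cell (signed_normal (insert h P) \<eta>) x (insert h J)))
    = of_bool (open_cell (signed_normal P \<eta>) x J \<noteq> {} \<and> v \<in> polar_cone (closed_cell (signed_normal P \<eta>) x J))
      + of_bool (open_cell (signed_normal P \<eta>) (x \<inter> {z. \<eta> h \<bullet> z = 0}) J \<noteq> {}
          \<and> v \<in> polar_cone (closed_cell (signed_normal P \<eta>) (x \<inter> {z. \<eta> h \<bullet> z = 0}) J))"
    if "P \<in> Pow J" for P
  proof -
    have h: "signed_normal P \<eta> h = - \<eta> h" "signed_normal (insert h P) \<eta> h = \<eta> h"
      using that assms(2) by (auto simp: signed_normal_def)
    have "signed_normal (insert h P) \<eta> j = signed_normal P \<eta> j" if "j \<in> J" for j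
      using that assms(2) by (auto simp: signed_normal_def)
    then have "open_cell (signed_normal (insert h P) \<eta>) x J = open_cell (signed_normal P \<eta>) x J"
      "closed_cell (signed_normal (insert h P) \<eta>) x J = closed_cell (signed_normal P \<eta>) x J"
      by (auto intro!: open_cell_cong closed_cell_cong)
    then show ?thesis
      unfolding open_cell_insert closed_cell_insert open_cell_Int closed_cell_Int h
      using cell_split[OF assms(1,3) w, of "signed_normal P \<eta>" v] by (simp add: add.commute)
  qed
  then show ?thesis
    unfolding cell_count_def sum_Pow_insert[OF assms(1,2)] sum.distrib[symmetric]
    by (intro sum.cong) auto
qed

lemma dim_Int_hyperplane:
  fixes a :: "'a::euclidean_space"
  assumes "subspace x" "\<not> x \<subseteq> {z. a \<bullet> z = 0}"
  shows "dim x = Suc (dim (x \<inter> {z. a \<bullet> z = 0}))"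
proof -
  have "0 \<in> x \<inter> {v. a \<bullet> v = 0}"
    using assms by (simp add: subspace_0)
  then have "aff_dim (x \<inter> {z. a \<bullet> z = 0}) = aff_dim x - 1"
    using aff_dim_affine_Int_hyperplane[OF subspace_imp_affine[OF assms(1)], of a 0] assms(2)
    by (metis empty_iff)
  moreover have "subspace (x \<inter> {z. a \<bullet> z = 0})"
    using assms by (simp add: subspace_inter subspace_hyperplane)
  ultimately show ?thesis
    using assms by (simp add: aff_dim_subspace)
qed

text \<open>Quantifying over all subsets of \<open>J\<close> makes the condition pass both to
  deletion (fewer sets) and to restriction (replace \<open>S\<close> by
  \<open>insert h S\<close>).\<close>

definition generic :: "(nat \<Rightarrow> 'a::euclidean_space) \<Rightarrow> 'a \<Rightarrow> 'a set \<Rightarrow> nat set \<Rightarrow> bool" where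
  "generic \<eta> v x J \<longleftrightarrow>
    (\<forall>S\<subseteq>J. x \<inter> flat \<eta> S \<subseteq> {z. v \<bullet> z = 0} \<longrightarrow> x \<inter> flat \<eta> S = {0})"

theorem cell_count_eq_whitney_sum:
  fixes \<eta> :: "nat \<Rightarrow> 'a::euclidean_space"
  assumes "finite J" "subspace x" "generic \<eta> v x J"
  shows "cell_count \<eta> v x J = (- 1) ^ dim x * whitney_sum \<eta> x {0} J"
  using assms
proof (induction J arbitrary: x rule: finite_induct)
  case empty
  have "v \<in> polar_cone x \<longleftrightarrow> x \<subseteq> {z. v \<bullet> z = 0}"
  proof
    assume v: "v \<in> polar_cone x"
    show "x \<subseteq> {z. v \<bullet> z = 0}"
    proof
      fix z assume "z \<in> x"
      then have "v \<bullet> z \<le> 0" "v \<bullet> (- z) \<le> 0"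
        using v subspace_neg[OF empty(1)] unfolding polar_cone_def by blast+
      then show "z \<in> {z. v \<bullet> z = 0}"
        by simp
    qed
  qed (auto simp: polar_cone_def)
  also have "\<dots> \<longleftrightarrow> x = {0}"
    using empty(2) by (auto simp: generic_def flat_def)
  finally have "v \<in> polar_cone x \<longleftrightarrow> x = {0}" .
  moreover have "x \<noteq> {}"
    using empty(1) subspace_0 by blast
  ultimately show ?case
    by (simp add: cell_count_def whitney_sum_def flat_def open_cell_def closed_cell_def)
next
  case (insert h J)
  let ?H = "{z. \<eta> h \<bullet> z = 0}"
  have gen: "generic \<eta> v x J"
    using insert.prems(2) by (auto simp: generic_def)
  show ?case
  proof (cases "x \<subseteq> ?H")
    case True
    then have "x \<inter> ?H = x"
      by blast
    then have "whitney_sum \<eta> x {0} (insert h J) = 0"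
      using insert.hyps by (simp add: whitney_sum_insert)
    moreover have "open_cell (signed_normal P \<eta>) x (insert h J) = {}" for P
      using True by (auto simp: open_cell_def signed_normal_def)
    ultimately show ?thesis
      by (simp add: cell_count_def)
  next
    case False
    have "generic \<eta> v (x \<inter> ?H) J"
      unfolding generic_def
    proof (intro allI impI)
      fix S assume "S \<subseteq> J" "x \<inter> ?H \<inter> flat \<eta> S \<subseteq> {z. v \<bullet> z = 0}"
      then show "x \<inter> ?H \<inter> flat \<eta> S = {0}"
        using insert.prems(2)[unfolded generic_def, rule_format, of "insert h S"]
        by (auto simp: flat_insert Int_assoc)
    qed
    moreover have "subspace (x \<inter> ?H)"
      using insert.prems by (simp add: subspace_inter subspace_hyperplane)
    ultimately have "cell_count \<eta> v (x \<inter> ?H) J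
        = (- 1) ^ dim (x \<inter> ?H) * whitney_sum \<eta> (x \<inter> ?H) {0} J"
      by (rule insert.IH[rotated])
    then show ?thesis
      using cell_count_insert[of J h x \<eta> v, OF insert.hyps insert.prems(1) False]
        insert.IH[OF insert.prems(1) gen] insert.hyps dim_Int_hyperplane[OF insert.prems(1) False]
      by (simp add: whitney_sum_insert algebra_simps)
  qed
qed

section \<open>The intersection lattice\<close>

lemma sum_moebius_mu:
  assumes "finite r" "Partial_order r" "(x, y) \<in> r"
  shows "(\<Sum>z\<in>{z. (x, z) \<in> r \<and> (z, y) \<in> r}. moebius_mu r x z) = (if x = y then 1 else 0)"
proof -
  have refl: "(x, x) \<in> r" "(y, y) \<in> r"
    using assms by (metis FieldI1 FieldI2 partial_order_onD(1) refl_onD)+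
  let ?Z = "{z. (x, z) \<in> r \<and> (z, y) \<in> r \<and> z \<noteq> y}"
  have "?Z \<subseteq> snd ` r"
    by force
  then have fin: "finite ?Z"
    using assms(1) finite_subset by blast
  have "{z. (x, z) \<in> r \<and> (z, y) \<in> r} = insert y ?Z"
    using assms(3) refl by auto
  then have "(\<Sum>z\<in>{z. (x, z) \<in> r \<and> (z, y) \<in> r}. moebius_mu r x z)
      = moebius_mu r x y + (\<Sum>z\<in>?Z. moebius_mu r x z)"
    using fin by simp
  note split = this
  show ?thesis
  proof (cases "x = y")
    case True
    then have "{z. (x, z) \<in> r \<and> (z, y) \<in> r} = {x}"
      using refl partial_order_onD(3)[OF assms(2)] by (auto dest: antisymD)
    then show ?thesis
      using True assms refl by (simp add: moebius_mu.simps[of r y y])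
  next
    case False
    then show ?thesis
      using split assms by (simp add: moebius_mu.simps[of r x y])
  qed
qed

text \<open>This is the fact that a left and a right inverse of the zeta function agree: the sum of
  \<open>moebius_mu r x z * moebius_mu (r\<inverse>) y w\<close> over \<open>z\<close> below
  \<open>w\<close> in the interval is evaluated in both orders.\<close>

lemma moebius_mu_converse:
  assumes r: "finite r" "Partial_order r" and xy: "(x, y) \<in> r"
  shows "moebius_mu (r\<inverse>) y x = moebius_mu r x y"
proof -
  have r': "finite (r\<inverse>)" "Partial_order (r\<inverse>)"
    using r by simp_all
  have trans: "(a, c) \<in> r" if "(a, b) \<in> r" "(b, c) \<in> r" for a b c
    using that partial_order_onD(2)[OF r(2)] by (auto dest: transD)
  have refl: "(x, x) \<in> r" "(y, y) \<in> r"
    using r xy by (metis FieldI1 FieldI2 partial_order_onD(1) refl_onD)+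
  let ?I = "{z. (x, z) \<in> r \<and> (z, y) \<in> r}"
  have "?I \<subseteq> snd ` r"
    by force
  then have fin: "finite ?I"
    using r(1) finite_subset by blast
  let ?f = "\<lambda>z w. moebius_mu r x z * moebius_mu (r\<inverse>) y w"
  have "moebius_mu r x y = (\<Sum>z\<in>?I. moebius_mu r x z * (if z = y then 1 else 0))"
    using fin xy refl by (simp add: if_distrib cong: if_cong)
  also have "\<dots> = (\<Sum>z\<in>?I. \<Sum>w\<in>{w \<in> ?I. (z, w) \<in> r}. ?f z w)"
  proof (rule sum.cong)
    fix z assume z: "z \<in> ?I"
    then have "{w. (y, w) \<in> r\<inverse> \<and> (w, z) \<in> r\<inverse>} = {w \<in> ?I. (z, w) \<in> r}"
      using trans by auto
    then show "moebius_mu r x z * (if z = y then 1 else 0) = (\<Sum>w\<in>{w \<in> ?I. (z, w) \<in> r}. ?f z w)"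
      using sum_moebius_mu[OF r', of y z] z by (auto simp: sum_distrib_left[symmetric])
  qed simp
  also have "\<dots> = (\<Sum>w\<in>?I. \<Sum>z\<in>{z \<in> ?I. (z, w) \<in> r}. ?f z w)"
    using fin by (rule sum.swap_restrict) (rule fin)
  also have "\<dots> = (\<Sum>w\<in>?I. (if x = w then 1 else 0) * moebius_mu (r\<inverse>) y w)"
  proof (rule sum.cong)
    fix w assume w: "w \<in> ?I"
    then have "{z. (x, z) \<in> r \<and> (z, w) \<in> r} = {z \<in> ?I. (z, w) \<in> r}"
      using trans by auto
    then show "(\<Sum>z\<in>{z \<in> ?I. (z, w) \<in> r}. ?f z w) = (if x = w then 1 else 0) * moebius_mu (r\<inverse>) y w"
      using sum_moebius_mu[OF r, of x w] w by (simp add: sum_distrib_right[symmetric])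
  qed simp
  also have "\<dots> = moebius_mu (r\<inverse>) y x"
    using fin xy refl by (simp add: if_distrib[where f = "\<lambda>t. t * _"] cong: if_cong)
  finally show ?thesis ..
qed

section \<open>Flats, and Whitney's theorem for their lattice\<close>

lemma Inter_hyperplanes: "\<Inter> ((\<lambda>j. {z. \<eta> j \<bullet> z = 0}) ` S) = flat \<eta> S"
  by (auto simp: flat_def)

lemma intersection_lattice_arrangement:
  "intersection_lattice (arrangement m \<eta>) = flat \<eta> ` Pow {1..m}"
proof -
  have "Pow (arrangement m \<eta>) = (\<lambda>S. (\<lambda>j. {z. \<eta> j \<bullet> z = 0}) ` S) ` Pow {1..m}"
    unfolding arrangement_def by (simp add: image_Pow_surj)
  then show ?thesis
    by (simp add: intersection_lattice_def image_image Inter_hyperplanes)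
qed

lemma intersection_order_arrangement:
  "(x, y) \<in> intersection_order (arrangement m \<eta>) \<longleftrightarrow>
    x \<in> flat \<eta> ` Pow {1..m} \<and> y \<in> flat \<eta> ` Pow {1..m} \<and> y \<subseteq> x"
  by (simp add: intersection_order_def relation_of_def intersection_lattice_arrangement)

lemma Chains_flats:
  "C \<in> Chains ((intersection_order (arrangement m \<eta>))\<inverse>) \<longleftrightarrow>
    C \<subseteq> flat \<eta> ` Pow {1..m} \<and> (\<forall>a\<in>C. \<forall>b\<in>C. a \<subseteq> b \<or> b \<subseteq> a)"
  unfolding Chains_def mem_Collect_eq converse_iff intersection_order_arrangement by blast

text \<open>Only these hyperplanes cut \<open>x\<close> properly. Any other one would empty all open
  cells in \<open>x\<close> and make the Whitney sum zero.\<close>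

definition active :: "nat \<Rightarrow> (nat \<Rightarrow> 'a::euclidean_space) \<Rightarrow> 'a set \<Rightarrow> nat set" where
  "active m \<eta> x = {j \<in> {1..m}. \<not> x \<subseteq> {z. \<eta> j \<bullet> z = 0}}"

lemma finite_active [simp]: "finite (active m \<eta> x)"
  by (simp add: active_def)

lemma active_subset: "active m \<eta> x \<subseteq> {1..m}"
  by (auto simp: active_def)

lemma flat_inactive:
  assumes "x \<in> flat \<eta> ` Pow {1..m}"
  shows "x = flat \<eta> ({1..m} - active m \<eta> x)"
  using assms by (auto simp: flat_def active_def)

lemma Int_flat_in_lattice:
  assumes "x \<in> flat \<eta> ` Pow {1..m}" "S \<subseteq> {1..m}"
  shows "x \<inter> flat \<eta> S \<in> flat \<eta> ` Pow {1..m}"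
proof -
  obtain T where "T \<subseteq> {1..m}" "x = flat \<eta> T"
    using assms by auto
  then have "x \<inter> flat \<eta> S = flat \<eta> (T \<union> S)" "T \<union> S \<in> Pow {1..m}"
    using assms by (auto simp: flat_def)
  then show ?thesis
    by blast
qed

text \<open>Each \<open>S\<close> contributes once, at \<open>z = x \<inter> flat \<eta> S\<close>,
  and this lies in the interval exactly if all hyperplanes of \<open>S\<close> contain
  \<open>y\<close>. What remains is an alternating sum over the subsets of \<open>?K\<close>, which
  vanishes unless no active hyperplane contains \<open>y\<close>; then \<open>x\<close> and
  \<open>y\<close> lie in the same hyperplanes and coincide.\<close>

lemma sum_whitney_sum:
  fixes \<eta> :: "nat \<Rightarrow> 'a::euclidean_space" and m :: nat
  defines "r \<equiv> intersection_order (arrangement m \<eta>)"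
  assumes "(x, y) \<in> r"
  shows "(\<Sum>z\<in>{z. (x, z) \<in> r \<and> (z, y) \<in> r}. whitney_sum \<eta> x z (active m \<eta> x))
    = (if x = y then 1 else 0)"
proof -
  let ?I = "{z. (x, z) \<in> r \<and> (z, y) \<in> r}" and ?J = "active m \<eta> x"
  let ?K = "{j \<in> ?J. y \<subseteq> {z. \<eta> j \<bullet> z = 0}}"
  have xy: "x \<in> flat \<eta> ` Pow {1..m}" "y \<in> flat \<eta> ` Pow {1..m}" "y \<subseteq> x"
    using assms by (auto simp: intersection_order_arrangement)
  have fin: "finite ?I"
    by (rule finite_subset[of _ "flat \<eta> ` Pow {1..m}"])
      (auto simp: r_def intersection_order_arrangement)
  have mem: "x \<inter> flat \<eta> S \<in> ?I \<longleftrightarrow> y \<subseteq> flat \<eta> S" if "S \<subseteq> ?J" for S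
    using Int_flat_in_lattice[OF xy(1), of S] that active_subset[of m \<eta> x] xy
    by (auto simp: r_def intersection_order_arrangement)
  have "(\<Sum>z\<in>?I. whitney_sum \<eta> x z ?J)
      = (\<Sum>S\<in>Pow ?J. \<Sum>z\<in>?I. if x \<inter> flat \<eta> S = z then (- 1) ^ card S else 0)"
    unfolding whitney_sum_def by (rule sum.swap)
  also have "\<dots> = (\<Sum>S\<in>Pow ?J. if y \<subseteq> flat \<eta> S then (- 1) ^ card S else 0)"
    using fin mem by (intro sum.cong) auto
  also have "\<dots> = (\<Sum>S\<in>{S \<in> Pow ?J. y \<subseteq> flat \<eta> S}. (- 1) ^ card S)"
    by (subst sum.inter_filter) auto
  also have "{S \<in> Pow ?J. y \<subseteq> flat \<eta> S} = Pow ?K"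
    by (auto simp: flat_def)
  also have "(\<Sum>S\<in>Pow ?K. (- 1 :: int) ^ card S) = (if ?K = {} then 1 else 0)"
    by (rule sum_Pow_alternating) simp
  also have "?K = {} \<longleftrightarrow> x = y"
  proof
    assume "?K = {}"
    then have "active m \<eta> x \<subseteq> active m \<eta> y"
      by (auto simp: active_def)
    then have "flat \<eta> ({1..m} - active m \<eta> x) \<subseteq> flat \<eta> ({1..m} - active m \<eta> y)"
      by (auto simp: flat_def)
    then show "x = y"
      using flat_inactive[OF xy(1)] flat_inactive[OF xy(2)] xy(3) by auto
  qed (auto simp: active_def)
  finally show ?thesis .
qed

text \<open>Both functions have the same sums over intervals, and these determine the value at
  \<open>y\<close> from the values at the other \<open>z\<close>. Such a \<open>z\<close> properly
  contains \<open>y\<close>, so the codimension serves as induction measure.\<close>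

lemma moebius_mu_eq_whitney_sum:
  fixes \<eta> :: "nat \<Rightarrow> 'a::euclidean_space" and m :: nat
  defines "r \<equiv> intersection_order (arrangement m \<eta>)"
  assumes "(x, y) \<in> r"
  shows "moebius_mu r x y = whitney_sum \<eta> x y (active m \<eta> x)"
  using assms(2)
proof (induction "DIM('a) - dim y" arbitrary: y rule: less_induct)
  case less
  let ?I = "{z. (x, z) \<in> r \<and> (z, y) \<in> r}" and ?J = "active m \<eta> x"
  have r: "finite r" "Partial_order r"
    unfolding r_def
    by (auto simp: Partial_order_intersection_order arrangement_def intro!: finite_intersection_order)
  have fin: "finite ?I"
    by (rule finite_subset[of _ "flat \<eta> ` Pow {1..m}"])
      (auto simp: r_def intersection_order_arrangement)
  have y: "y \<in> ?I"
    using less.prems by (auto simp: r_def intersection_order_arrangement)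
  have IH: "moebius_mu r x z = whitney_sum \<eta> x z ?J" if "z \<in> ?I - {y}" for z
  proof (rule less.hyps)
    have "subspace y" "subspace z" "y \<subset> z"
      using that by (auto simp: r_def intersection_order_arrangement subspace_flat)
    then have "dim y < dim z"
      by (metis dim_psubset span_eq_iff)
    then show "DIM('a) - dim z < DIM('a) - dim y"
      using dim_subset_UNIV[of z] by linarith
  qed (use that in auto)
  have "moebius_mu r x y + (\<Sum>z\<in>?I - {y}. moebius_mu r x z)
      = whitney_sum \<eta> x y ?J + (\<Sum>z\<in>?I - {y}. whitney_sum \<eta> x z ?J)"
    using sum_moebius_mu[OF r less.prems] sum_whitney_sum[OF less.prems[unfolded r_def]]
    unfolding sum.remove[OF fin y] r_def[symmetric] sum.remove[OF fin y] by simp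
  then show ?case
    using IH by simp
qed

section \<open>Ranks and the characteristic polynomial of the dual lattice\<close>

context
  fixes \<eta> :: "nat \<Rightarrow> 'a::euclidean_space" and m :: nat
  assumes essential: "span (\<eta> ` {1..m}) = UNIV"
begin

lemma flat_all: "flat \<eta> {1..m} = {0}"
proof -
  have "z = 0" if "z \<in> flat \<eta> {1..m}" for z
  proof -
    have "span (\<eta> ` {1..m}) \<subseteq> {w. z \<bullet> w = 0}"
      using that by (intro span_minimal subspace_hyperplane) (auto simp: flat_def inner_commute)
    then have "z \<bullet> z = 0"
      using essential by blast
    then show ?thesis
      by simp
  qed
  then show ?thesis
    by (auto simp: flat_def)
qed

lemma zero_in_lattice: "{0} \<in> flat \<eta> ` Pow {1..m}"
  using flat_all by blast

text \<open>As the arrangement is essential, a flat other than \<open>{0}\<close> is cut by some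
  hyperplane, and each cut lowers the dimension by exactly one.\<close>

lemma ex_chain_of_flats:
  assumes "x \<in> flat \<eta> ` Pow {1..m}"
  shows "\<exists>C. C \<in> Chains ((intersection_order (arrangement m \<eta>))\<inverse>)
    \<and> (\<forall>y\<in>C. y \<subseteq> x) \<and> card C = Suc (dim x)"
  using assms
proof (induction "dim x" arbitrary: x)
  case 0
  then have "x = {0}"
    by (metis dim_eq_0 subspace_flat imageE subset_singletonD subspace_0 empty_iff)
  then show ?case
    using 0 by (intro exI[of _ "{{0}}"])
      (auto simp: Chains_def intersection_order_arrangement)
next
  case (Suc n)
  have sub: "subspace x"
    using Suc.prems subspace_flat by blast
  have "x \<noteq> {0}"
    using Suc.hyps(2) by auto
  then obtain j where j: "j \<in> {1..m}" "\<not> x \<subseteq> {z. \<eta> j \<bullet> z = 0}"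
    using flat_all subspace_0[OF sub] by (force simp: flat_def)
  let ?y = "x \<inter> {z. \<eta> j \<bullet> z = 0}"
  have y: "?y \<in> flat \<eta> ` Pow {1..m}"
    using Int_flat_in_lattice[OF Suc.prems, of "{j}"] j by (simp add: flat_def)
  have dy: "dim x = Suc (dim ?y)"
    using dim_Int_hyperplane[OF sub j(2)] .
  then obtain C where C: "C \<in> Chains ((intersection_order (arrangement m \<eta>))\<inverse>)"
    "\<forall>y\<in>C. y \<subseteq> ?y" "card C = Suc (dim ?y)"
    using Suc.hyps(1)[OF _ y] Suc.hyps(2) by auto
  have "x \<notin> C"
    using C(2) j(2) by blast
  moreover have "finite C"
    using C(3) card.infinite by force
  moreover have "insert x C \<in> Chains ((intersection_order (arrangement m \<eta>))\<inverse>)"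
    using C(1,2) Suc.prems unfolding Chains_flats by blast
  ultimately show ?case
    using C dy by (intro exI[of _ "insert x C"]) auto
qed

text \<open>Nested subspaces of equal dimension are equal, so \<open>dim\<close> is injective on a
  chain and takes values in \<open>{..dim x}\<close>.\<close>

lemma card_chain_of_flats:
  assumes "C \<in> Chains ((intersection_order (arrangement m \<eta>))\<inverse>)" "\<forall>y\<in>C. y \<subseteq> x"
  shows "card C \<le> Suc (dim x)"
proof -
  have "inj_on dim C"
  proof (rule inj_onI)
    fix y z assume "y \<in> C" "z \<in> C" "dim y = dim z"
    moreover from this have "subspace y" "subspace z" "y \<subseteq> z \<or> z \<subseteq> y"
      using assms(1) subspace_flat unfolding Chains_flats by blast+
    ultimately show "y = z"
      by (metis order_refl subspace_dim_equal)
  qed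
  moreover have "dim ` C \<subseteq> {..dim x}"
    using assms(2) by (auto intro: dim_subset)
  ultimately have "card C \<le> card {..dim x}"
    by (rule card_inj_on_le) simp
  then show ?thesis
    by simp
qed

lemma rank_of_flat:
  assumes "x \<in> flat \<eta> ` Pow {1..m}"
  shows "rank_of ((intersection_order (arrangement m \<eta>))\<inverse>) x = dim x"
  unfolding rank_of_def
proof (rule Max_eqI)
  let ?r = "(intersection_order (arrangement m \<eta>))\<inverse>"
  have below: "(\<forall>y\<in>C. (y, x) \<in> ?r) \<longleftrightarrow> (\<forall>y\<in>C. y \<subseteq> x)" if "C \<in> Chains ?r" for C
    using that assms unfolding Chains_flats converse_iff intersection_order_arrangement by blast
  have "Chains ?r \<subseteq> Pow (flat \<eta> ` Pow {1..m})"
    using Chains_flats by blast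
  then have "finite (Chains ?r)"
    by (rule finite_subset) simp
  then show "finite ((\<lambda>C. card C - 1) ` {C \<in> Chains ?r. \<forall>y\<in>C. (y, x) \<in> ?r})"
    by simp
  show "k \<le> dim x" if "k \<in> (\<lambda>C. card C - 1) ` {C \<in> Chains ?r. \<forall>y\<in>C. (y, x) \<in> ?r}" for k
    using that below card_chain_of_flats[of _ x] by fastforce
  obtain C where "C \<in> Chains ?r" "\<forall>y\<in>C. y \<subseteq> x" "card C = Suc (dim x)"
    using ex_chain_of_flats[OF assms] by blast
  then show "dim x \<in> (\<lambda>C. card C - 1) ` {C \<in> Chains ?r. \<forall>y\<in>C. (y, x) \<in> ?r}"
    using below by (intro image_eqI[of _ _ C]) auto
qed

lemma poset_rank_flats: "poset_rank ((intersection_order (arrangement m \<eta>))\<inverse>) = DIM('a)"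
proof -
  let ?r = "(intersection_order (arrangement m \<eta>))\<inverse>"
  have U: "UNIV \<in> flat \<eta> ` Pow {1..m}"
    by (rule image_eqI[of _ _ "{}"]) (auto simp: flat_def)
  \<comment> \<open>The whole space is the greatest element of the dual, so its rank is a maximum
    over all chains.\<close>
  then have "\<forall>y\<in>C. (y, UNIV) \<in> ?r" if "C \<in> Chains ?r" for C
    using that unfolding Chains_flats converse_iff intersection_order_arrangement by blast
  then have "{C \<in> Chains ?r. \<forall>y\<in>C. (y, UNIV) \<in> ?r} = Chains ?r"
    by blast
  then show ?thesis
    using rank_of_flat[OF U] by (simp add: poset_rank_def rank_of_def)
qed

lemma poset_min_flats: "poset_min ((intersection_order (arrangement m \<eta>))\<inverse>) = {0}"
  unfolding poset_min_def
proof (rule the_equality)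
  let ?r = "(intersection_order (arrangement m \<eta>))\<inverse>"
  have F: "Field ?r = flat \<eta> ` Pow {1..m}"
    by (simp add: Field_intersection_order intersection_lattice_arrangement)
  show *: "{0} \<in> Field ?r \<and> (\<forall>x\<in>Field ?r. ({0}, x) \<in> ?r)"
    unfolding F using zero_in_lattice by (auto simp: intersection_order_arrangement subspace_flat subspace_0)
  show "b = {0}" if "b \<in> Field ?r \<and> (\<forall>x\<in>Field ?r. (b, x) \<in> ?r)" for b
    using that * by (auto simp: intersection_order_arrangement)
qed

lemma coeff_characteristic_poly_flats:
  "coeff (characteristic_poly ((intersection_order (arrangement m \<eta>))\<inverse>)) i =
    (\<Sum>x\<in>{x \<in> intersection_lattice (arrangement m \<eta>). dim x + i = DIM('a)}.
       moebius_mu (intersection_order (arrangement m \<eta>)) x {0})"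
proof -
  let ?r = "intersection_order (arrangement m \<eta>)" and ?L = "flat \<eta> ` Pow {1..m}"
  have r: "finite ?r" "Partial_order ?r"
    by (auto simp: Partial_order_intersection_order arrangement_def intro!: finite_intersection_order)
  have "coeff (characteristic_poly (?r\<inverse>)) i
      = (\<Sum>x\<in>?L. if DIM('a) - dim x = i then moebius_mu (?r\<inverse>) {0} x else 0)"
    by (simp add: characteristic_poly_def Field_intersection_order intersection_lattice_arrangement
        coeff_sum poset_min_flats poset_rank_flats rank_of_flat)
  \<comment> \<open>The exponent is a truncated difference; \<open>dim x \<le> DIM('a)\<close> makes
    it exact.\<close>
  also have "\<dots> = (\<Sum>x\<in>?L. if dim x + i = DIM('a) then moebius_mu ?r x {0} else 0)"
  proof (rule sum.cong)
    fix x assume x: "x \<in> ?L"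
    then have "(x, {0}) \<in> ?r"
      using zero_in_lattice by (auto simp: intersection_order_arrangement subspace_flat subspace_0)
    moreover have "dim x \<le> DIM('a)"
      by (rule dim_subset_UNIV)
    ultimately show "(if DIM('a) - dim x = i then moebius_mu (?r\<inverse>) {0} x else 0)
        = (if dim x + i = DIM('a) then moebius_mu ?r x {0} else 0)"
      using moebius_mu_converse[OF r] by auto
  qed simp
  also have "\<dots> = (\<Sum>x\<in>{x \<in> ?L. dim x + i = DIM('a)}. moebius_mu ?r x {0})"
    by (subst sum.inter_filter) auto
  finally show ?thesis
    by (simp add: intersection_lattice_arrangement)
qed

end

section \<open>Faces of the zonotope\<close>

lemma polytope_set_plus:
  fixes S T :: "'a::euclidean_space set"
  assumes "polytope S" "polytope T"
  shows "polytope (S + T)"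
proof -
  obtain A B where "finite A" "S = convex hull A" "finite B" "T = convex hull B"
    using assms by (auto simp: polytope_def)
  then show ?thesis
    unfolding polytope_def by (intro exI[of _ "A + B"]) (simp add: convex_hull_set_plus finite_set_plus)
qed

text \<open>A Minkowski sum of segments. Being a polytope makes every face exposed and provides the
  finite description by halfspaces used for the tangent cones.\<close>

lemma polytope_zonotope: "polytope (zonotope m \<eta>)"
  for \<eta> :: "nat \<Rightarrow> 'a::euclidean_space"
proof (induction m)
  case 0
  have "zonotope 0 \<eta> = {0}"
    by (auto simp: zonotope_def)
  then show ?case
    using polytope_convex_hull[of "{0::'a}"] by simp
next
  case (Suc m)
  have "zonotope (Suc m) \<eta> = zonotope m \<eta> + (\<lambda>t. t *\<^sub>R \<eta> (Suc m)) ` {-1..1}"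
  proof (intro equalityI subsetI)
    fix z assume "z \<in> zonotope (Suc m) \<eta>"
    then obtain c where c: "z = (\<Sum>j=1..Suc m. c j *\<^sub>R \<eta> j)" "\<forall>j\<in>{1..Suc m}. - 1 \<le> c j \<and> c j \<le> 1"
      by (auto simp: zonotope_def)
    then have "z = (\<Sum>j=1..m. c j *\<^sub>R \<eta> j) + c (Suc m) *\<^sub>R \<eta> (Suc m)"
      by simp
    moreover have "(\<Sum>j=1..m. c j *\<^sub>R \<eta> j) \<in> zonotope m \<eta>"
      using c(2) by (auto simp: zonotope_def)
    ultimately show "z \<in> zonotope m \<eta> + (\<lambda>t. t *\<^sub>R \<eta> (Suc m)) ` {-1..1}"
      using c(2) by (auto intro!: set_plus_intro)
  next
    fix z assume "z \<in> zonotope m \<eta> + (\<lambda>t. t *\<^sub>R \<eta> (Suc m)) ` {-1..1}"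
    then obtain c t where c: "z = (\<Sum>j=1..m. c j *\<^sub>R \<eta> j) + t *\<^sub>R \<eta> (Suc m)"
      "\<forall>j\<in>{1..m}. - 1 \<le> c j \<and> c j \<le> 1" "-1 \<le> t" "t \<le> 1"
      by (auto simp: zonotope_def elim!: set_plus_elim)
    have "(\<Sum>j=1..m. c j *\<^sub>R \<eta> j) = (\<Sum>j=1..m. (c(Suc m := t)) j *\<^sub>R \<eta> j)"
      by (intro sum.cong) auto
    then have "z = (\<Sum>j=1..Suc m. (c(Suc m := t)) j *\<^sub>R \<eta> j)"
      using c(1) by simp
    then show "z \<in> zonotope (Suc m) \<eta>"
      unfolding zonotope_def using c(2-) by (auto intro!: exI[of _ "c(Suc m := t)"])
  qed
  moreover have "polytope ((\<lambda>t. t *\<^sub>R \<eta> (Suc m)) ` {-1..1})"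
    using polytope_linear_image[OF _ polytope_interval[of "-1" "1::real"], of "\<lambda>t. t *\<^sub>R \<eta> (Suc m)"]
    by (simp add: linear_scaleR_left)
  ultimately show ?case
    using polytope_set_plus[OF Suc] by simp
qed

text \<open>The support function of the zonotope, that is the maximum of
  \<open>u \<bullet> z\<close>, attained with the coefficients
  \<open>sgn (\<eta> j \<bullet> u)\<close>.\<close>

definition support :: "nat \<Rightarrow> (nat \<Rightarrow> 'a::euclidean_space) \<Rightarrow> 'a \<Rightarrow> real" where
  "support m \<eta> u = (\<Sum>j=1..m. \<bar>\<eta> j \<bullet> u\<bar>)"

text \<open>A translate of the zonotope of the normals orthogonal to \<open>x\<close>; the sign
  pattern \<open>P\<close> on the active normals fixes the translation.\<close>

definition zonotope_face :: "nat \<Rightarrow> (nat \<Rightarrow> 'a::euclidean_space) \<Rightarrow> 'a set \<Rightarrow> nat set \<Rightarrow> 'a set" where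
  "zonotope_face m \<eta> x P =
    {\<Sum>j=1..m. c j *\<^sub>R \<eta> j | c :: nat \<Rightarrow> real. (\<forall>j\<in>{1..m}. - 1 \<le> c j \<and> c j \<le> 1)
      \<and> (\<forall>j\<in>active m \<eta> x. c j = (if j \<in> P then 1 else - 1))}"

definition face_center :: "nat \<Rightarrow> (nat \<Rightarrow> 'a::euclidean_space) \<Rightarrow> 'a set \<Rightarrow> nat set \<Rightarrow> 'a" where
  "face_center m \<eta> x P =
    (\<Sum>j=1..m. (if j \<in> active m \<eta> x then if j \<in> P then 1 else - 1 else 0) *\<^sub>R \<eta> j)"

lemma inner_sum_scaleR: "u \<bullet> (\<Sum>j\<in>A. c j *\<^sub>R \<eta> j) = (\<Sum>j\<in>A. c j * (\<eta> j \<bullet> u))"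
  by (simp add: inner_sum_right inner_commute)

lemma mult_le_abs: "- 1 \<le> c \<Longrightarrow> c \<le> 1 \<Longrightarrow> c * t \<le> \<bar>t\<bar>" for c t :: real
  using mult_right_mono[of c 1 t] mult_right_mono_neg[of "- 1" c t] by (cases "t \<ge> 0") auto

lemma zonotope_inner_le_support:
  assumes "z \<in> zonotope m \<eta>"
  shows "u \<bullet> z \<le> support m \<eta> u"
  using assms unfolding zonotope_def support_def
  by (auto simp: inner_sum_scaleR intro!: sum_mono mult_le_abs)

lemma support_attained: "\<exists>z\<in>zonotope m \<eta>. u \<bullet> z = support m \<eta> u"
proof (rule bexI)
  show "u \<bullet> (\<Sum>j=1..m. sgn (\<eta> j \<bullet> u) *\<^sub>R \<eta> j) = support m \<eta> u"
    by (simp only: inner_sum_scaleR support_def abs_sgn mult.commute)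
  show "(\<Sum>j=1..m. sgn (\<eta> j \<bullet> u) *\<^sub>R \<eta> j) \<in> zonotope m \<eta>"
    unfolding zonotope_def by (auto simp: sgn_real_def intro!: exI[of _ "\<lambda>j. sgn (\<eta> j \<bullet> u)"])
qed

text \<open>Each summand is at most its absolute value, so the sums agree only if all summands
  do.\<close>

lemma inner_eq_support_iff:
  assumes "\<forall>j\<in>{1..m}. - 1 \<le> c j \<and> c j \<le> 1"
  shows "u \<bullet> (\<Sum>j=1..m. c j *\<^sub>R \<eta> j) = support m \<eta> u \<longleftrightarrow>
    (\<forall>j\<in>{1..m}. c j * (\<eta> j \<bullet> u) = \<bar>\<eta> j \<bullet> u\<bar>)"
proof -
  have "u \<bullet> (\<Sum>j=1..m. c j *\<^sub>R \<eta> j) = support m \<eta> u \<longleftrightarrow>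
    (\<Sum>j=1..m. \<bar>\<eta> j \<bullet> u\<bar> - c j * (\<eta> j \<bullet> u)) = 0"
    by (auto simp: inner_sum_scaleR support_def sum_subtractf)
  also have "\<dots> \<longleftrightarrow> (\<forall>j\<in>{1..m}. \<bar>\<eta> j \<bullet> u\<bar> - c j * (\<eta> j \<bullet> u) = 0)"
    using assms by (intro sum_nonneg_eq_0_iff) (auto intro: mult_le_abs)
  finally show ?thesis
    by auto
qed

lemma face_center_in_face: "face_center m \<eta> x P \<in> zonotope_face m \<eta> x P"
  unfolding face_center_def zonotope_face_def mem_Collect_eq
  by (rule exI[of _ "\<lambda>j. if j \<in> active m \<eta> x then if j \<in> P then 1 else - 1 else 0"]) simp

lemma inactive_inner: "u \<in> x \<Longrightarrow> j \<in> {1..m} \<Longrightarrow> j \<notin> active m \<eta> x \<Longrightarrow> \<eta> j \<bullet> u = 0"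
  by (auto simp: active_def)

lemma face_subset_zonotope: "zonotope_face m \<eta> x P \<subseteq> zonotope m \<eta>"
  by (auto simp: zonotope_face_def zonotope_def)

lemma zonotope_face_inner:
  assumes u: "u \<in> closed_cell (signed_normal P \<eta>) x (active m \<eta> x)" and z: "z \<in> zonotope_face m \<eta> x P"
  shows "u \<bullet> z = support m \<eta> u"
proof -
  obtain c where c: "z = (\<Sum>j=1..m. c j *\<^sub>R \<eta> j)" "\<forall>j\<in>{1..m}. - 1 \<le> c j \<and> c j \<le> 1"
    "\<forall>j\<in>active m \<eta> x. c j = (if j \<in> P then 1 else - 1)"
    using z by (auto simp: zonotope_face_def)
  have "c j * (\<eta> j \<bullet> u) = \<bar>\<eta> j \<bullet> u\<bar>" if "j \<in> {1..m}" for j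
  proof (cases "j \<in> active m \<eta> x")
    case True
    then have "signed_normal P \<eta> j \<bullet> u \<ge> 0"
      using u by (simp add: closed_cell_def)
    then show ?thesis
      using True c(3) by (simp add: signed_normal_def split: if_splits)
  next
    case False
    then have "\<eta> j \<bullet> u = 0"
      using inactive_inner[OF _ that] u by (auto simp: closed_cell_def)
    then show ?thesis
      by simp
  qed
  then show ?thesis
    using inner_eq_support_iff[OF c(2), of u \<eta>] c(1) by simp
qed

text \<open>The normal cone at the center is exactly the closed chamber: a coefficient 0 is optimal
  only if \<open>\<eta> j \<bullet> u = 0\<close>, which over the inactive indices says
  \<open>u \<in> x\<close>, and a coefficient 1 or -1 prescribes the sign of
  \<open>\<eta> j \<bullet> u\<close>.\<close>

lemma face_center_inner_iff:
  assumes "x \<in> flat \<eta> ` Pow {1..m}"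
  shows "u \<bullet> face_center m \<eta> x P = support m \<eta> u \<longleftrightarrow> u \<in> closed_cell (signed_normal P \<eta>) x (active m \<eta> x)"
proof
  assume "u \<bullet> face_center m \<eta> x P = support m \<eta> u"
  then have *: "(if j \<in> active m \<eta> x then if j \<in> P then 1 else - 1 else 0) * (\<eta> j \<bullet> u) = \<bar>\<eta> j \<bullet> u\<bar>"
    if "j \<in> {1..m}" for j
    unfolding face_center_def using that by (subst (asm) inner_eq_support_iff) auto
  have "u \<in> flat \<eta> ({1..m} - active m \<eta> x)"
    using * by (fastforce simp: flat_def)
  then have "u \<in> x"
    using flat_inactive[OF assms] by simp
  moreover have "signed_normal P \<eta> j \<bullet> u \<ge> 0" if "j \<in> active m \<eta> x" for j
    using *[of j] that active_subset[of m \<eta> x] by (auto simp: signed_normal_def split: if_splits)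
  ultimately show "u \<in> closed_cell (signed_normal P \<eta>) x (active m \<eta> x)"
    by (simp add: closed_cell_def)
next
  assume "u \<in> closed_cell (signed_normal P \<eta>) x (active m \<eta> x)"
  then show "u \<bullet> face_center m \<eta> x P = support m \<eta> u"
    using zonotope_face_inner face_center_in_face by blast
qed

lemma open_cell_subset_closed: "open_cell b x J \<subseteq> closed_cell b x J"
  by (auto simp: open_cell_def closed_cell_def)

text \<open>Where \<open>\<eta> j \<bullet> u\<close> is nonzero, optimality forces the coefficient
  to be its sign; on an open cell this covers all active indices.\<close>

lemma zonotope_face_eq:
  assumes u: "u \<in> open_cell (signed_normal P \<eta>) x (active m \<eta> x)"
  shows "zonotope_face m \<eta> x P = zonotope m \<eta> \<inter> {z. u \<bullet> z = support m \<eta> u}"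
proof (intro equalityI subsetI)
  fix z assume "z \<in> zonotope_face m \<eta> x P"
  then show "z \<in> zonotope m \<eta> \<inter> {z. u \<bullet> z = support m \<eta> u}"
    using zonotope_face_inner[of u] u open_cell_subset_closed face_subset_zonotope by blast
next
  fix z assume "z \<in> zonotope m \<eta> \<inter> {z. u \<bullet> z = support m \<eta> u}"
  then obtain c where c: "z = (\<Sum>j=1..m. c j *\<^sub>R \<eta> j)" "\<forall>j\<in>{1..m}. - 1 \<le> c j \<and> c j \<le> 1"
    and "u \<bullet> z = support m \<eta> u"
    by (auto simp: zonotope_def)
  then have *: "c j * (\<eta> j \<bullet> u) = \<bar>\<eta> j \<bullet> u\<bar>" if "j \<in> {1..m}" for j
    using that inner_eq_support_iff[OF c(2), of u \<eta>] by simp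
  have "c j = (if j \<in> P then 1 else - 1)" if "j \<in> active m \<eta> x" for j
  proof -
    have "signed_normal P \<eta> j \<bullet> u > 0"
      using that u by (simp add: open_cell_def)
    moreover have "c j * (\<eta> j \<bullet> u) = \<bar>\<eta> j \<bullet> u\<bar>"
      using * that active_subset by blast
    moreover have "c j = - 1" if "c j * (\<eta> j \<bullet> u) = (- 1) * (\<eta> j \<bullet> u)" "\<eta> j \<bullet> u < 0"
      using that mult_right_cancel[of "\<eta> j \<bullet> u" "c j" "- 1"] by linarith
    ultimately show ?thesis
      by (auto simp: signed_normal_def split: if_splits)
  qed
  then show "z \<in> zonotope_face m \<eta> x P"
    using c by (auto simp: zonotope_face_def)
qed

lemma zonotope_support_face: "(zonotope m \<eta> \<inter> {z. u \<bullet> z = support m \<eta> u}) face_of zonotope m \<eta>"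
  by (intro face_of_Int_supporting_hyperplane_le polytope_imp_convex polytope_zonotope
      zonotope_inner_le_support)

text \<open>An exposing direction \<open>u\<close> determines the data: \<open>x\<close> is the
  smallest flat containing \<open>u\<close>, and \<open>P\<close> records the normals positive at
  \<open>u\<close>.\<close>

lemma nonempty_face_zonotope:
  assumes "F face_of zonotope m \<eta>" "F \<noteq> {}"
  obtains x P where "x \<in> flat \<eta> ` Pow {1..m}" "P \<subseteq> active m \<eta> x"
    "open_cell (signed_normal P \<eta>) x (active m \<eta> x) \<noteq> {}" "F = zonotope_face m \<eta> x P"
proof -
  have "F exposed_face_of zonotope m \<eta>"
    using assms(1) exposed_face_of_polyhedron[OF polytope_imp_polyhedron[OF polytope_zonotope]] by blast
  then obtain u b where ub: "zonotope m \<eta> \<subseteq> {z. u \<bullet> z \<le> b}" "F = zonotope m \<eta> \<inter> {z. u \<bullet> z = b}"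
    by (auto simp: exposed_face_of_def)
  obtain z where "z \<in> zonotope m \<eta>" "u \<bullet> z = b"
    using assms(2) ub by blast
  then have "b = support m \<eta> u"
    using support_attained[of m \<eta> u] ub zonotope_inner_le_support[of z m \<eta> u] by force
  define x where "x = flat \<eta> {j\<in>{1..m}. \<eta> j \<bullet> u = 0}"
  define P where "P = {j\<in>{1..m}. \<eta> j \<bullet> u > 0}"
  have "u \<in> x"
    by (simp add: x_def flat_def)
  then have act: "active m \<eta> x = {j\<in>{1..m}. \<eta> j \<bullet> u \<noteq> 0}"
    by (auto simp: active_def x_def flat_def)
  then have u: "u \<in> open_cell (signed_normal P \<eta>) x (active m \<eta> x)"
    using \<open>u \<in> x\<close> by (auto simp: open_cell_def signed_normal_def P_def)
  show ?thesis
  proof (rule that)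
    show "x \<in> flat \<eta> ` Pow {1..m}"
      by (auto simp: x_def)
    show "P \<subseteq> active m \<eta> x"
      by (auto simp: act P_def)
    show "open_cell (signed_normal P \<eta>) x (active m \<eta> x) \<noteq> {}"
      using u by blast
    show "F = zonotope_face m \<eta> x P"
      using ub(2) zonotope_face_eq[OF u] \<open>b = support m \<eta> u\<close> by simp
  qed
qed

text \<open>A direction exposing the common face is optimal at both centers, so it lies in the open
  cell of one pair and in the closed cell of the other. Being nonzero on an active normal carries
  over, so the active sets agree, and then the signs do.\<close>

lemma zonotope_face_inj:
  assumes x: "x \<in> flat \<eta> ` Pow {1..m}" "P \<subseteq> active m \<eta> x"
      "open_cell (signed_normal P \<eta>) x (active m \<eta> x) \<noteq> {}"
    and y: "y \<in> flat \<eta> ` Pow {1..m}" "Q \<subseteq> active m \<eta> y"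
      "open_cell (signed_normal Q \<eta>) y (active m \<eta> y) \<noteq> {}"
    and eq: "zonotope_face m \<eta> x P = zonotope_face m \<eta> y Q"
  shows "x = y \<and> P = Q"
proof -
  obtain u w where u: "u \<in> open_cell (signed_normal P \<eta>) x (active m \<eta> x)"
    and w: "w \<in> open_cell (signed_normal Q \<eta>) y (active m \<eta> y)"
    using x y by blast
  have wx: "w \<in> closed_cell (signed_normal P \<eta>) x (active m \<eta> x)"
    using face_center_in_face[of m \<eta> x P] zonotope_face_eq[OF w] eq face_center_inner_iff[OF x(1)]
    by auto
  have uy: "u \<in> closed_cell (signed_normal Q \<eta>) y (active m \<eta> y)"
    using face_center_in_face[of m \<eta> y Q] zonotope_face_eq[OF u] eq face_center_inner_iff[OF y(1)]
    by auto
  have "active m \<eta> y \<subseteq> active m \<eta> x"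
  proof
    fix j assume j: "j \<in> active m \<eta> y"
    then have "\<eta> j \<bullet> w \<noteq> 0"
      using w by (fastforce simp: open_cell_def signed_normal_def split: if_splits)
    then show "j \<in> active m \<eta> x"
      using j wx by (auto simp: active_def closed_cell_def)
  qed
  moreover have "active m \<eta> x \<subseteq> active m \<eta> y"
  proof
    fix j assume j: "j \<in> active m \<eta> x"
    then have "\<eta> j \<bullet> u \<noteq> 0"
      using u by (fastforce simp: open_cell_def signed_normal_def split: if_splits)
    then show "j \<in> active m \<eta> y"
      using j uy by (auto simp: active_def closed_cell_def)
  qed
  ultimately have act: "active m \<eta> x = active m \<eta> y"
    by blast
  then have "x = y"
    using flat_inactive[OF x(1)] flat_inactive[OF y(1)] by simp
  moreover have "j \<in> P \<longleftrightarrow> j \<in> Q" if j: "j \<in> active m \<eta> x" for j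
  proof -
    have "signed_normal P \<eta> j \<bullet> w \<ge> 0" "signed_normal Q \<eta> j \<bullet> w > 0"
      using j act wx w by (auto simp: open_cell_def closed_cell_def)
    then show ?thesis
      by (auto simp: signed_normal_def split: if_splits)
  qed
  ultimately show ?thesis
    using x(2) y(2) act by blast
qed

section \<open>Dimensions of faces, and faces indexed by chambers in flats\<close>

lemma dim_flat: "dim (flat \<eta> S) + dim (span (\<eta> ` S)) = DIM('a)"
  for \<eta> :: "nat \<Rightarrow> 'a::euclidean_space"
proof -
  have "flat \<eta> S = {y \<in> UNIV. \<forall>w\<in>span (\<eta> ` S). orthogonal w y}"
  proof (intro equalityI subsetI)
    fix y assume y: "y \<in> flat \<eta> S"
    have "span (\<eta> ` S) \<subseteq> {w. y \<bullet> w = 0}"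
      using y by (intro span_minimal subspace_hyperplane) (auto simp: flat_def inner_commute)
    then show "y \<in> {y \<in> UNIV. \<forall>w\<in>span (\<eta> ` S). orthogonal w y}"
      by (auto simp: orthogonal_def inner_commute)
  qed (auto simp: flat_def orthogonal_def span_base)
  then show ?thesis
    using dim_subspace_orthogonal_to_vectors[of "span (\<eta> ` S)" UNIV] by simp
qed

lemma aff_dim_zonotope_face:
  fixes \<eta> :: "nat \<Rightarrow> 'a::euclidean_space"
  assumes "x \<in> flat \<eta> ` Pow {1..m}"
  shows "aff_dim (zonotope_face m \<eta> x P) = int DIM('a) - int (dim x)"
proof -
  let ?c = "face_center m \<eta> x P" and ?F = "zonotope_face m \<eta> x P"
  let ?N = "{1..m} - active m \<eta> x"
  let ?s = "\<lambda>j. if j \<in> active m \<eta> x then if j \<in> P then 1 else - 1 else (0::real)"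
  have "span ((+) (- ?c) ` ?F) = span (\<eta> ` ?N)"
  proof (rule span_eq[THEN iffD2], intro conjI)
    show "(+) (- ?c) ` ?F \<subseteq> span (\<eta> ` ?N)"
    proof (intro image_subsetI)
      fix z assume "z \<in> ?F"
      then obtain c where c: "z = (\<Sum>j=1..m. c j *\<^sub>R \<eta> j)"
        "\<forall>j\<in>active m \<eta> x. c j = (if j \<in> P then 1 else - 1)"
        by (auto simp: zonotope_face_def)
      have "- ?c + z = (\<Sum>j=1..m. (c j - ?s j) *\<^sub>R \<eta> j)"
        by (simp add: c(1) face_center_def scaleR_diff_left sum_subtractf)
      also have "\<dots> \<in> span (\<eta> ` ?N)"
      proof (rule span_sum)
        fix j assume "j \<in> {1..m}"
        then show "(c j - ?s j) *\<^sub>R \<eta> j \<in> span (\<eta> ` ?N)"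
          using c(2) by (cases "j \<in> active m \<eta> x") (simp_all add: span_zero span_scale span_base)
      qed
      finally show "- ?c + z \<in> span (\<eta> ` ?N)" .
    qed
    show "\<eta> ` ?N \<subseteq> span ((+) (- ?c) ` ?F)"
    proof (intro image_subsetI)
      fix k assume k: "k \<in> ?N"
      \<comment> \<open>The center has coefficient 0 at the inactive index \<open>k\<close>; raising
        it to 1 stays in the face and moves by \<open>\<eta> k\<close>.\<close>
      have "\<eta> k = (\<Sum>j=1..m. if j = k then \<eta> j else 0)"
        using k by simp
      also have "\<dots> = (\<Sum>j=1..m. (if j = k then 1 else 0) *\<^sub>R \<eta> j)"
        by (intro sum.cong) auto
      finally have "?c + \<eta> k = (\<Sum>j=1..m. ?s j *\<^sub>R \<eta> j) + (\<Sum>j=1..m. (if j = k then 1 else 0) *\<^sub>R \<eta> j)"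
        by (simp only: face_center_def)
      also have "\<dots> = (\<Sum>j=1..m. (?s j + (if j = k then 1 else 0)) *\<^sub>R \<eta> j)"
        by (simp only: scaleR_add_left sum.distrib)
      finally have "?c + \<eta> k = (\<Sum>j=1..m. (?s j + (if j = k then 1 else 0)) *\<^sub>R \<eta> j)" .
      moreover have "\<dots> \<in> ?F"
        unfolding zonotope_face_def using k
        by (auto intro!: exI[of _ "\<lambda>j. ?s j + (if j = k then 1 else 0)"])
      ultimately have "?c + \<eta> k \<in> ?F"
        by simp
      then have "- ?c + (?c + \<eta> k) \<in> (+) (- ?c) ` ?F"
        by blast
      then show "\<eta> k \<in> span ((+) (- ?c) ` ?F)"
        by (simp add: span_base)
    qed
  qed
  then have "dim ((+) (- ?c) ` ?F) = dim (span (\<eta> ` ?N))"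
    by (metis dim_span)
  moreover have "?c \<in> affine hull ?F"
    by (simp add: face_center_in_face hull_inc)
  moreover have "dim x + dim (span (\<eta> ` ?N)) = DIM('a)"
    using dim_flat[of \<eta> ?N] flat_inactive[OF assms] by simp
  ultimately show ?thesis
    using aff_dim_eq_dim by fastforce
qed

lemma zonotope_faces_bij:
  fixes \<eta> :: "nat \<Rightarrow> 'a::euclidean_space"
  shows "bij_betw (\<lambda>(x, P). zonotope_face m \<eta> x P)
    (SIGMA x:{x \<in> flat \<eta> ` Pow {1..m}. dim x + i = DIM('a)}.
       {P \<in> Pow (active m \<eta> x). open_cell (signed_normal P \<eta>) x (active m \<eta> x) \<noteq> {}})
    {F. F face_of zonotope m \<eta> \<and> aff_dim F = int i}"
  unfolding bij_betw_def
proof (intro conjI inj_onI equalityI subsetI)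
  let ?I = "SIGMA x:{x \<in> flat \<eta> ` Pow {1..m}. dim x + i = DIM('a)}.
       {P \<in> Pow (active m \<eta> x). open_cell (signed_normal P \<eta>) x (active m \<eta> x) \<noteq> {}}"
  show "p = q" if "p \<in> ?I" "q \<in> ?I"
    "(case p of (x, P) \<Rightarrow> zonotope_face m \<eta> x P) = (case q of (x, P) \<Rightarrow> zonotope_face m \<eta> x P)" for p q
  proof -
    obtain x P y Q where pq: "p = (x, P)" "q = (y, Q)"
      by fastforce
    show ?thesis
      using zonotope_face_inj[of x \<eta> m P y Q] that unfolding pq by auto
  qed
  show "F \<in> {F. F face_of zonotope m \<eta> \<and> aff_dim F = int i}"
    if F: "F \<in> (\<lambda>(x, P). zonotope_face m \<eta> x P) ` ?I" for F
  proof -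
    obtain x P where xP: "(x, P) \<in> ?I" "F = zonotope_face m \<eta> x P"
      using F by blast
    then obtain u where u: "u \<in> open_cell (signed_normal P \<eta>) x (active m \<eta> x)"
      by blast
    have "F face_of zonotope m \<eta>"
      unfolding xP(2) zonotope_face_eq[OF u] by (rule zonotope_support_face)
    moreover have "aff_dim F = int DIM('a) - int (dim x)"
      unfolding xP(2) by (rule aff_dim_zonotope_face) (use xP(1) in blast)
    moreover have "dim x + i = DIM('a)"
      using xP(1) by blast
    ultimately show ?thesis
      by auto
  qed
  show "F \<in> (\<lambda>(x, P). zonotope_face m \<eta> x P) ` ?I"
    if F: "F \<in> {F. F face_of zonotope m \<eta> \<and> aff_dim F = int i}" for F
  proof -
    \<comment> \<open>The empty face has affine dimension -1 and is excluded by
      \<open>int i\<close>.\<close>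
    have "F face_of zonotope m \<eta>" "F \<noteq> {}"
      using F by auto
    then obtain x P where xP: "x \<in> flat \<eta> ` Pow {1..m}" "P \<subseteq> active m \<eta> x"
      "open_cell (signed_normal P \<eta>) x (active m \<eta> x) \<noteq> {}" "F = zonotope_face m \<eta> x P"
      by (rule nonempty_face_zonotope)
    then have "dim x + i = DIM('a)"
      using F aff_dim_zonotope_face[OF xP(1), of P] by simp
    then show ?thesis
      using xP by (intro image_eqI[of _ _ "(x, P)"]) auto
  qed
qed

section \<open>Solid angles of the zonotope\<close>

lemma closed_polar_cone: "closed (polar_cone C)"
proof -
  have "polar_cone C = (\<Inter>z\<in>C. {v. z \<bullet> v \<le> 0})"
    by (auto simp: polar_cone_def inner_commute)
  then show ?thesis
    by (auto intro!: closed_INT closed_halfspace_le)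
qed

lemma polar_cone_scale:
  assumes "e > 0"
  shows "e *\<^sub>R v \<in> polar_cone C \<longleftrightarrow> v \<in> polar_cone C"
  using assms by (simp add: polar_cone_def mult_le_0_iff)

lemma measure_ball_Int_polar_cone:
  fixes C :: "'a::euclidean_space set"
  assumes "e > 0"
  shows "measure lebesgue ((+) a ` (ball 0 e \<inter> polar_cone C))
    = e ^ DIM('a) * measure lebesgue (ball 0 1 \<inter> polar_cone C)"
proof -
  have "(\<lambda>v. e *\<^sub>R v + a) ` (ball 0 1 \<inter> polar_cone C) = (+) a ` (ball 0 e \<inter> polar_cone C)"
  proof (intro equalityI subsetI)
    fix z assume "z \<in> (\<lambda>v. e *\<^sub>R v + a) ` (ball 0 1 \<inter> polar_cone C)"
    then obtain v where v: "z = e *\<^sub>R v + a" "v \<in> ball 0 1 \<inter> polar_cone C"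
      by blast
    then have "e *\<^sub>R v \<in> ball 0 e \<inter> polar_cone C"
      using assms by (simp add: polar_cone_scale)
    then show "z \<in> (+) a ` (ball 0 e \<inter> polar_cone C)"
      using v(1) by (auto simp: add.commute)
  next
    fix z assume "z \<in> (+) a ` (ball 0 e \<inter> polar_cone C)"
    then obtain v where v: "z = a + v" "v \<in> ball 0 e \<inter> polar_cone C"
      by blast
    then have "(1 / e) *\<^sub>R v \<in> ball 0 1 \<inter> polar_cone C"
      using assms polar_cone_scale[of "1 / e" v C] by (simp add: field_simps)
    moreover have "z = e *\<^sub>R ((1 / e) *\<^sub>R v) + a"
      using assms v(1) by simp
    ultimately show "z \<in> (\<lambda>v. e *\<^sub>R v + a) ` (ball 0 1 \<inter> polar_cone C)"
      by blast
  qed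
  then show ?thesis
    using measure_lebesgue_affine[of e a "ball 0 1 \<inter> polar_cone C"] assms by simp
qed

text \<open>
  Only the facet inequalities that are tight at the given point matter nearby, and by the choice
  of the point in the relative interior their normals lie in the normal cone of the face.
\<close>

lemma zonotope_locally_polar_cone:
  fixes \<eta> :: "nat \<Rightarrow> 'a::euclidean_space"
  assumes x: "x \<in> flat \<eta> ` Pow {1..m}"
    and p: "p \<in> rel_interior (zonotope_face m \<eta> x P)"
  defines "C \<equiv> closed_cell (signed_normal P \<eta>) x (active m \<eta> x)"
  shows "\<forall>\<^sub>F e in at_right 0. \<forall>v. norm v < e \<longrightarrow> (p + v \<in> zonotope m \<eta> \<longleftrightarrow> v \<in> polar_cone C)"
proof -
  have pF: "p \<in> zonotope_face m \<eta> x P"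
    using p rel_interior_subset by blast
  have pZ: "p \<in> zonotope m \<eta>"
    using pF face_subset_zonotope by blast
  have polar: "v \<in> polar_cone C" if "p + v \<in> zonotope m \<eta>" for v
  proof -
    have "v \<bullet> z \<le> 0" if "z \<in> C" for z
      using zonotope_inner_le_support[OF \<open>p + v \<in> zonotope m \<eta>\<close>, of z]
        zonotope_face_inner[OF \<open>z \<in> C\<close>[unfolded C_def] pF]
      by (simp add: inner_right_distrib inner_commute)
    then show ?thesis
      by (simp add: polar_cone_def)
  qed
  obtain \<H> where \<H>: "finite \<H>" "zonotope m \<eta> = \<Inter>\<H>"
    "\<And>h. h \<in> \<H> \<Longrightarrow> \<exists>a b. a \<noteq> 0 \<and> h = {z. a \<bullet> z \<le> b}"
    using polytope_imp_polyhedron[OF polytope_zonotope, of m \<eta>] unfolding polyhedron_def by metis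
  have "\<forall>\<^sub>F e in at_right 0. \<forall>h\<in>\<H>. \<forall>v. norm v < e \<longrightarrow> v \<in> polar_cone C \<longrightarrow> p + v \<in> h"
  proof (rule eventually_ball_finite[OF \<H>(1)], intro ballI)
    fix h assume h: "h \<in> \<H>"
    then obtain a b where ab: "h = {z. a \<bullet> z \<le> b}"
      using \<H>(3) by blast
    have Zh: "zonotope m \<eta> \<subseteq> h"
      using \<H>(2) h by blast
    show "\<forall>\<^sub>F e in at_right 0. \<forall>v. norm v < e \<longrightarrow> v \<in> polar_cone C \<longrightarrow> p + v \<in> h"
    proof (cases "a \<bullet> p = b")
      case True
      obtain z where "z \<in> zonotope m \<eta>" "a \<bullet> z = support m \<eta> a"
        using support_attained by blast
      then have "support m \<eta> a \<le> b"
        using Zh ab by auto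
      then have "a \<bullet> p = support m \<eta> a"
        using zonotope_inner_le_support[OF pZ, of a] True by simp
      \<comment> \<open>A face meeting the relative interior of another one contains it; this moves
        the tight inequality from \<open>p\<close> to the center, where the normal cone is
        known.\<close>
      then have "zonotope_face m \<eta> x P \<subseteq> zonotope m \<eta> \<inter> {z. a \<bullet> z = support m \<eta> a}"
        using p pZ by (intro subset_of_face_of[OF zonotope_support_face face_subset_zonotope]) blast
      then have "a \<bullet> face_center m \<eta> x P = support m \<eta> a"
        using face_center_in_face by blast
      then have "a \<in> C"
        unfolding C_def using face_center_inner_iff[OF x] by blast
      then have "p + v \<in> h" if "v \<in> polar_cone C" for v
        using that True by (simp add: ab polar_cone_def inner_right_distrib inner_commute)
      then show ?thesis
        by simp
    next
      case False
      then have "p \<in> {z. a \<bullet> z < b}"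
        using Zh pZ ab by (auto simp: order_less_le)
      then obtain e0 where e0: "e0 > 0" "ball p e0 \<subseteq> {z. a \<bullet> z < b}"
        using open_contains_ball[of "{z. a \<bullet> z < b}"] open_halfspace_lt by blast
      have "p + v \<in> h" if "norm v < e0" for v
      proof -
        have "p + v \<in> ball p e0"
          using that by (simp add: dist_norm)
        then show ?thesis
          using e0(2) ab by auto
      qed
      moreover have "\<forall>\<^sub>F e in at_right 0. e < e0"
        using e0(1) by (rule order_tendstoD(2)[OF tendsto_ident_at])
      ultimately show ?thesis
        by (auto elim!: eventually_mono)
    qed
  qed
  then show ?thesis
    by eventually_elim (use polar \<H>(2) in auto)
qed

lemma convex_zonotope_face:
  assumes "u \<in> open_cell (signed_normal P \<eta>) x (active m \<eta> x)"
  shows "convex (zonotope_face m \<eta> x P)"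
  using face_of_imp_convex[OF zonotope_support_face] zonotope_face_eq[OF assms] by simp

lemma solid_angle_zonotope_face:
  fixes \<eta> :: "nat \<Rightarrow> 'a::euclidean_space"
  assumes x: "x \<in> flat \<eta> ` Pow {1..m}" and ne: "open_cell (signed_normal P \<eta>) x (active m \<eta> x) \<noteq> {}"
  shows "solid_angle (zonotope m \<eta>) (zonotope_face m \<eta> x P) =
    measure lebesgue (ball 0 1 \<inter> polar_cone (closed_cell (signed_normal P \<eta>) x (active m \<eta> x)))
      / measure lebesgue (ball (0::'a) 1)"
    (is "_ = ?A")
proof -
  let ?F = "zonotope_face m \<eta> x P" and ?C = "closed_cell (signed_normal P \<eta>) x (active m \<eta> x)"
  have ev: "\<forall>\<^sub>F e in at_right 0.
      measure lebesgue (ball p e \<inter> zonotope m \<eta>) / measure lebesgue (ball p e) = ?A"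
    if p: "p \<in> rel_interior ?F" for p
    using zonotope_locally_polar_cone[OF x p] eventually_at_right_less[of 0]
  proof eventually_elim
    case (elim e)
    have "ball p e \<inter> zonotope m \<eta> = (+) p ` (ball 0 e \<inter> polar_cone ?C)"
    proof (intro equalityI subsetI)
      fix z assume z: "z \<in> ball p e \<inter> zonotope m \<eta>"
      then have "z - p \<in> ball 0 e \<inter> polar_cone ?C"
        using elim(1)[rule_format, of "z - p"] by (auto simp: dist_norm norm_minus_commute)
      then have "p + (z - p) \<in> (+) p ` (ball 0 e \<inter> polar_cone ?C)"
        by blast
      then show "z \<in> (+) p ` (ball 0 e \<inter> polar_cone ?C)"
        by simp
    next
      fix z assume "z \<in> (+) p ` (ball 0 e \<inter> polar_cone ?C)"
      then show "z \<in> ball p e \<inter> zonotope m \<eta>"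
        using elim(1) by (auto simp: dist_norm)
    qed
    moreover have "measure lebesgue (ball p e) = e ^ DIM('a) * measure lebesgue (ball (0::'a) 1)"
      using content_ball_conv_unit_ball[of e p] elim(2) by simp
    ultimately show ?case
      using measure_ball_Int_polar_cone[OF elim(2), of p ?C] elim(2) by simp
  qed
  \<comment> \<open>Uniqueness of the value described by \<open>solid_angle\<close> needs a relative
    interior point; without one the condition would hold for every number.\<close>
  obtain u where "u \<in> open_cell (signed_normal P \<eta>) x (active m \<eta> x)"
    using ne by blast
  then have "rel_interior ?F \<noteq> {}"
    using rel_interior_eq_empty[OF convex_zonotope_face] face_center_in_face[of m \<eta> x P] by blast
  then obtain p where p: "p \<in> rel_interior ?F"
    by blast
  show ?thesis
    unfolding solid_angle_def
  proof (rule the_equality)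
    fix a
    assume "\<forall>x\<in>rel_interior ?F. \<forall>\<^sub>F \<epsilon> in at_right 0.
      measure lebesgue (ball x \<epsilon> \<inter> zonotope m \<eta>) / measure lebesgue (ball x \<epsilon>) = a"
    then have "\<forall>\<^sub>F e in at_right 0.
        measure lebesgue (ball p e \<inter> zonotope m \<eta>) / measure lebesgue (ball p e) = a"
      using p by blast
    then have "\<forall>\<^sub>F e in at_right (0::real). a = ?A"
      using ev[OF p] by eventually_elim simp
    then show "a = ?A"
      by simp
  qed (use ev in blast)
qed

text \<open>For each \<open>S\<close>, a bad \<open>v\<close> is orthogonal to a fixed nonzero
  vector of the flat, so the bad directions lie in finitely many hyperplanes.\<close>

lemma generic_AE:
  fixes \<eta> :: "nat \<Rightarrow> 'a::euclidean_space"
  assumes "finite J" "subspace x"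
  shows "AE v in lebesgue. generic \<eta> v x J"
proof -
  have "AE v in lebesgue. x \<inter> flat \<eta> S \<subseteq> {z. v \<bullet> z = 0} \<longrightarrow> x \<inter> flat \<eta> S = {0}" for S
  proof (cases "x \<inter> flat \<eta> S = {0}")
    case False
    moreover have "0 \<in> x \<inter> flat \<eta> S"
      using assms(2) subspace_flat subspace_0 by blast
    ultimately obtain z where z: "z \<in> x \<inter> flat \<eta> S" "z \<noteq> 0"
      by blast
    have "{v. z \<bullet> v = 0} \<in> null_sets lebesgue"
      using negligible_hyperplane[of z 0] z(2) by (simp add: negligible_iff_null_sets)
    then have "AE v in lebesgue. v \<notin> {v. z \<bullet> v = 0}"
      by (rule AE_not_in)
    then show ?thesis
      by eventually_elim (use z in \<open>auto simp: inner_commute\<close>)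
  qed simp
  then have "AE v in lebesgue. \<forall>S\<in>Pow J. x \<inter> flat \<eta> S \<subseteq> {z. v \<bullet> z = 0} \<longrightarrow> x \<inter> flat \<eta> S = {0}"
    using assms(1) by (intro AE_finite_allI) auto
  then show ?thesis
    by (simp add: generic_def Ball_def)
qed

text \<open>The sum of the measures is the integral over the unit ball of the number of polar cones
  containing \<open>v\<close>, which for almost every \<open>v\<close> is the constant of
  \<open>cell_count_eq_whitney_sum\<close>.\<close>

lemma sum_measure_polar_cones:
  fixes \<eta> :: "nat \<Rightarrow> 'a::euclidean_space"
  assumes "finite J" "subspace x"
  shows "(\<Sum>P\<in>{P \<in> Pow J. open_cell (signed_normal P \<eta>) x J \<noteq> {}}.
      measure lebesgue (ball 0 1 \<inter> polar_cone (closed_cell (signed_normal P \<eta>) x J)))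
    = (- 1) ^ dim x * real_of_int (whitney_sum \<eta> x {0} J) * measure lebesgue (ball (0::'a) 1)"
proof -
  let ?I = "{P \<in> Pow J. open_cell (signed_normal P \<eta>) x J \<noteq> {}}"
  let ?T = "\<lambda>P. ball 0 1 \<inter> polar_cone (closed_cell (signed_normal P \<eta>) x J)"
  let ?N = "(- 1) ^ dim x * real_of_int (whitney_sum \<eta> x {0} J)"
  have fin: "finite ?I"
    using assms(1) by simp
  have T: "?T P \<in> lmeasurable" for P
    by (intro fmeasurable_Int_fmeasurable lmeasurable_ball) (simp add: closed_polar_cone borel_closed)
  have "(\<Sum>P\<in>?I. measure lebesgue (?T P)) = (\<Sum>P\<in>?I. \<integral>v. indicator (?T P) v \<partial>lebesgue)"
    by simp
  also have "\<dots> = (\<integral>v. (\<Sum>P\<in>?I. indicator (?T P) v) \<partial>lebesgue)"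
    using T by (intro Bochner_Integration.integral_sum[symmetric])
      (blast intro: lmeasurable_iff_integrable[THEN iffD1])
  also have "\<dots> = (\<integral>v. ?N * indicator (ball (0::'a) 1) v \<partial>lebesgue)"
  proof (rule Bochner_Integration.integral_cong_AE)
    show "AE v in lebesgue. (\<Sum>P\<in>?I. indicator (?T P) v) = ?N * indicator (ball (0::'a) 1) v"
      using generic_AE[OF assms, of \<eta>]
    proof eventually_elim
      case (elim v)
      have "(\<Sum>P\<in>?I. of_bool (v \<in> polar_cone (closed_cell (signed_normal P \<eta>) x J)))
          = real_of_int (cell_count \<eta> v x J)"
        unfolding cell_count_def of_int_sum
        by (subst sum.inter_filter[OF finite_Pow_iff[THEN iffD2, OF assms(1)]])
          (intro sum.cong refl, auto)
      also have "\<dots> = ?N"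
        using cell_count_eq_whitney_sum[OF assms elim] by simp
      finally have *: "(\<Sum>P\<in>?I. of_bool (v \<in> polar_cone (closed_cell (signed_normal P \<eta>) x J))) = ?N" .
      have "(\<Sum>P\<in>?I. indicator (?T P) v :: real)
          = (\<Sum>P\<in>?I. of_bool (v \<in> polar_cone (closed_cell (signed_normal P \<eta>) x J))
              * indicator (ball (0::'a) 1) v)"
        by (intro sum.cong) (auto simp: indicator_def)
      also have "\<dots> = ?N * indicator (ball (0::'a) 1) v"
        by (simp only: sum_distrib_right[symmetric] *)
      finally show ?case .
    qed
    show "(\<lambda>v. \<Sum>P\<in>?I. indicator (?T P) v :: real) \<in> borel_measurable lebesgue"
      by (intro borel_measurable_sum borel_measurable_indicator fmeasurableD T)
    show "(\<lambda>v. ?N * indicator (ball (0::'a) 1) v) \<in> borel_measurable lebesgue"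
      by (intro borel_measurable_times borel_measurable_const borel_measurable_indicator
          fmeasurableD lmeasurable_ball)
  qed
  also have "\<dots> = ?N * measure lebesgue (ball (0::'a) 1)"
    by simp
  finally show ?thesis .
qed

lemma angle_sum_zonotope:
  fixes \<eta> :: "nat \<Rightarrow> 'a::euclidean_space"
  assumes essential: "span (\<eta> ` {1..m}) = UNIV"
  defines "r \<equiv> intersection_order (arrangement m \<eta>)"
  shows "angle_sum i (zonotope m \<eta>) =
    (\<Sum>x\<in>{x \<in> intersection_lattice (arrangement m \<eta>). dim x + i = DIM('a)}.
       (- 1) ^ dim x * real_of_int (moebius_mu r x {0}))"
proof -
  let ?X = "{x \<in> flat \<eta> ` Pow {1..m}. dim x + i = DIM('a)}"
  let ?I = "\<lambda>x. {P \<in> Pow (active m \<eta> x). open_cell (signed_normal P \<eta>) x (active m \<eta> x) \<noteq> {}}"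
  let ?A = "\<lambda>x P. solid_angle (zonotope m \<eta>) (zonotope_face m \<eta> x P)"
  let ?B = "measure lebesgue (ball (0::'a) 1)"
  have B: "?B > 0"
    using content_ball_pos[of 1 "0::'a"] by simp
  have "angle_sum i (zonotope m \<eta>) = (\<Sum>(x, P)\<in>(SIGMA x:?X. ?I x). ?A x P)"
    unfolding angle_sum_def
    by (subst sum.reindex_bij_betw[OF zonotope_faces_bij, symmetric]) (simp add: case_prod_beta)
  also have "\<dots> = (\<Sum>x\<in>?X. \<Sum>P\<in>?I x. ?A x P)"
    by (rule sum.Sigma[symmetric]) auto
  also have "\<dots> = (\<Sum>x\<in>?X. (- 1) ^ dim x * real_of_int (moebius_mu r x {0}))"
  proof (rule sum.cong)
    fix x assume "x \<in> ?X"
    then have x: "x \<in> flat \<eta> ` Pow {1..m}"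
      by blast
    then have sub: "subspace x"
      using subspace_flat by blast
    have "(x, {0}) \<in> r"
      using x zero_in_lattice[OF essential] subspace_0[OF sub]
      unfolding r_def intersection_order_arrangement by blast
    then have mu: "moebius_mu r x {0} = whitney_sum \<eta> x {0} (active m \<eta> x)"
      unfolding r_def by (rule moebius_mu_eq_whitney_sum)
    have "(\<Sum>P\<in>?I x. ?A x P)
        = (\<Sum>P\<in>?I x. measure lebesgue
            (ball 0 1 \<inter> polar_cone (closed_cell (signed_normal P \<eta>) x (active m \<eta> x)))) / ?B"
      using solid_angle_zonotope_face[OF x] by (simp add: sum_divide_distrib)
    also have "\<dots> = (- 1) ^ dim x * real_of_int (moebius_mu r x {0})"
      using B by (simp only: sum_measure_polar_cones[OF finite_active sub] mu) simp
    finally show "(\<Sum>P\<in>?I x. ?A x P) = (- 1) ^ dim x * real_of_int (moebius_mu r x {0})" .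
  qed simp
  finally show ?thesis
    by (simp add: intersection_lattice_arrangement)
qed

text \<open>Allows the absolute value on the side of the angles to be dropped at the end. As
  \<open>solid_angle\<close> is a definite description, its sign is read off from the value computed
  for each face.\<close>

lemma angle_sum_nonneg:
  fixes \<eta> :: "nat \<Rightarrow> 'a::euclidean_space"
  shows "angle_sum i (zonotope m \<eta>) \<ge> 0"
  unfolding angle_sum_def
proof (rule sum_nonneg)
  fix F assume F: "F \<in> {F. F face_of zonotope m \<eta> \<and> aff_dim F = int i}"
  then have "F face_of zonotope m \<eta>" "F \<noteq> {}"
    by auto
  then obtain x P where "x \<in> flat \<eta> ` Pow {1..m}" "open_cell (signed_normal P \<eta>) x (active m \<eta> x) \<noteq> {}"
    "F = zonotope_face m \<eta> x P"
    by (rule nonempty_face_zonotope)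
  then show "solid_angle (zonotope m \<eta>) F \<ge> 0"
    by (simp add: solid_angle_zonotope_face)
qed

theorem theorem12:
  fixes \<eta> :: "nat \<Rightarrow> real ^ 'n" and m i :: nat
  assumes nonzero: "\<And>j. j \<in> {1..m} \<Longrightarrow> \<eta> j \<noteq> 0"
    and essential: "span (\<eta> ` {1..m}) = UNIV"
  shows "angle_sum i (zonotope m \<eta>) =
      \<bar>real_of_int (coeff (characteristic_poly ((intersection_order (arrangement m \<eta>))\<inverse>)) i)\<bar>
    \<and> angle_sum i (zonotope m \<eta>) =
      \<bar>real_of_int (\<Sum>x\<in>{x \<in> intersection_lattice (arrangement m \<eta>). dim x + i = CARD('n)}.
         moebius_mu (intersection_order (arrangement m \<eta>)) x {0})\<bar>"
proof -
  let ?X = "{x \<in> intersection_lattice (arrangement m \<eta>). dim x + i = CARD('n)}"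
  let ?\<mu> = "\<lambda>x. moebius_mu (intersection_order (arrangement m \<eta>)) x {0}"
  have "angle_sum i (zonotope m \<eta>) = (\<Sum>x\<in>?X. (- 1) ^ dim x * real_of_int (?\<mu> x))"
    using angle_sum_zonotope[OF essential, of i] by simp
  \<comment> \<open>If \<open>i\<close> exceeds the dimension, \<open>?X\<close> is empty and the
    truncated exponent is harmless.\<close>
  also have "\<dots> = (\<Sum>x\<in>?X. (- 1) ^ (CARD('n) - i) * real_of_int (?\<mu> x))"
  proof (rule sum.cong)
    fix x assume "x \<in> ?X"
    then have "CARD('n) - i = dim x"
      by auto
    then show "(- 1) ^ dim x * real_of_int (?\<mu> x) = (- 1) ^ (CARD('n) - i) * real_of_int (?\<mu> x)"
      by simp
  qed simp
  also have "\<dots> = (- 1) ^ (CARD('n) - i) * real_of_int (\<Sum>x\<in>?X. ?\<mu> x)"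
    by (simp add: sum_distrib_left)
  finally have "\<bar>angle_sum i (zonotope m \<eta>)\<bar> = \<bar>real_of_int (\<Sum>x\<in>?X. ?\<mu> x)\<bar>"
    by (simp add: abs_mult power_abs)
  then show ?thesis
    using angle_sum_nonneg[of i m \<eta>] coeff_characteristic_poly_flats[OF essential, of i] by simp
qed

end
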